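(* Let $q$ be a prime power, $n\ge 2$, and let $f(x)=\sum_{i=0}^{n-1}a_ix^{q^i}\in\mathbb{F}_{q^n}[x]$ be a $q$-polynomial with maximum field of linearity $\mathbb{F}_q$. Suppose that $\mathcal{D}_f=\{\langle (x,f(x),0)\rangle_{\mathbb{F}_{q^n}} : x\in\mathbb{F}_{q^n}^*\}\subseteq \ell_\infty$ has weight distribution $(1,i_2,\ldots,i_t)$. Then the following hold for $\mathcal{B}_f$: (i) if $i_t<n-1$, then $\mathcal{B}_f$ is of type $(1,q+1,q^{i_2}+1,\ldots,q^{i_t}+1,|\mathcal{D}_f|)$, and $\mathcal{B}_f$ admits $t+2$ intersection numbers; (ii) if $i_t=n-1$, i.e. the weight distribution of $\mathcal{D}_f$ is $(1,n-1)$, then either $n>2$ and $\mathcal{B}_f$ is of type $(1,q+1,q^{n-1}+1)$, or $n=2$ and $\mathcal{B}_f$ is of type $(1,q+1)$; in both cases $\mathcal{B}_f$ is $\mathrm{P\Gamma L}(3,q^n)$-equivalent to $\mathcal{B}_{\mathrm{Tr}}$, where $\mathrm{Tr}(x)=\sum_{i=0}^{n-1}x^{q^i}$. The following hold for $\mathcal{C}_f$: (j) if $q>2$, then $\mathcal{C}_f$ is of type $(0,2,q,q^{i_2},\ldots,q^{i_t},q^n+1-|\mathcal{D}_f|)$, and $\mathcal{C}_f$ admits $t+3$ intersection numbers; (jj) if $q=2$ and $t>2$, then $\mathcal{C}_f$ is of type $(0,q,q^{i_2},\ldots,q^{i_t},q^n+1-|\mathcal{D}_f|)$, and $\mathcal{C}_f$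 admits $t+2$ intersection numbers; (jjj) if $q=2$, $t=2$ and the weight distribution of $\mathcal{D}_f$ is $(1,i)$, then $\mathcal{C}_f$ is of type $(0,2,2^i)$ if $\mathcal{D}_f$ is an $i$-club in $\mathrm{PG}(1,2^n)$, and otherwise $\mathcal{C}_f$ is of type $(0,2,2^i,2^n+1-|\mathcal{D}_f|)$; (jv) if $q=2$ and $t=1$, then $\mathcal{C}_f$ is of type $(0,q)$ and $\mathcal{D}_f$ is a scattered linear set in $\mathrm{PG}(1,2^n)$. Moreover, if $i_t<n-1$ then for each weight $i_j$ the number of lines meeting $\mathcal{B}_f$ in exactly $q^{i_j}+1$ points is $q^{n-i_j}N_{i_j}$, and if $q>2$ then the number of lines meeting $\mathcal{C}_f$ in exactly $q^{i_j}$ points is $q^{n-i_j}N_{i_j}$, where $N_{i_j}$ is the frequency of the weight $i_j$ (with $i_1=1$).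
   Context: $\mathrm{PG}(2,q^n)$ is the projective plane whose points are the 1-dimensional $\mathbb{F}_{q^n}$-subspaces $\langle v\rangle_{\mathbb{F}_{q^n}}$ of $\mathbb{F}_{q^n}^3$; $\ell_\infty$ is the line $x_3=0$. For a $q$-polynomial $f$ put $U_f=\{(x,f(x),0):x\in\mathbb{F}_{q^n}\}$ (an $n$-dimensional $\mathbb{F}_q$-subspace), $\mathcal{D}_f=\{\langle (x,f(x),0)\rangle : x\neq 0\}$, $\mathcal{G}_f=\{\langle (x,f(x),1)\rangle : x\in\mathbb{F}_{q^n}\}$, $\mathcal{B}_f=\mathcal{G}_f\cup\mathcal{D}_f$ and $\mathcal{C}_f=\mathcal{G}_f\cup(\ell_\infty\setminus\mathcal{D}_f)$. The weight of a point $P=\langle v\rangle$ of $\mathcal{D}_f$ is $\dim_{\mathbb{F}_q}(U_f\cap\langle v\rangle_{\mathbb{F}_{q^n}})$. $\mathcal{D}_f$ has weight distribution $(i_1,\ldots,i_t)$ if $i_1<\dots<i_t$ are exactly the distinct weights of points of $\mathcal{D}_f$; the frequency $N_{i_j}$ of $i_j$ is the number of points of weight $i_j$. $\mathcal{D}_f$ is an $i$-club ($1\le i<n$) if exactly one of its points has weight $i$ and all others have weight $1$; it is scattered if all its points have weight $1$. The polynomial $f$ has maximum field of linearity $\mathbb{F}_q$ if there is no divisor $d>1$ of $n$ such that $f(\lambda x)=\lambda f(x)$ for all $\lambda\in\mathbb{F}_{q^d}$, $x\in\mathbb{F}_{q^n}$. A set $K$ of points of $\mathrm{PG}(2,q^n)$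 is of type $(m_1,\ldots,m_s)$ if $|\ell\cap K|\in\{m_1,\ldots,m_s\}$ for every line $\ell$ and each $m_i$ equals $|\ell\cap K|$ for some line $\ell$; the $m_i$ are the intersection numbers. Two pointsets are $\mathrm{P\Gamma L}(3,q^n)$-equivalent if some collineation in $\mathrm{P\Gamma L}(3,q^n)$ maps one onto the other. *)

theory Defs
  imports "HOL-Analysis.Analysis" "HOL-Number_Theory.Prime_Powers"
    "HOL-Computational_Algebra.Polynomial"
begin

(* In everything below 'a plays the role of the field with q^n elements. *)

definition pg_points :: "('a::field ^ 3) set set" where
  "pg_points = {vec.span {v} |v. v \<noteq> 0}"

definition points_in :: "('a::field ^ 3) set \<Rightarrow> ('a ^ 3) set set" where
  "points_in W = {P \<in> pg_points. P \<subseteq> W}"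

definition pg_lines :: "('a::field ^ 3) set set set" where
  "pg_lines = {points_in W |W. vec.subspace W \<and> vec.dim W = 2}"

definition line_infty :: "('a::field ^ 3) set set" where
  "line_infty = points_in {v. v $ 3 = 0}"

definition intersection_numbers :: "('a::field ^ 3) set set \<Rightarrow> nat set" where
  "intersection_numbers K = {card (l \<inter> K) |l. l \<in> pg_lines}"

definition of_type :: "('a::field ^ 3) set set \<Rightarrow> nat list \<Rightarrow> bool" where
  "of_type K ms \<longleftrightarrow>
     (\<forall>l\<in>pg_lines. card (l \<inter> K) \<in> set ms) \<and>
     (\<forall>m\<in>set ms. \<exists>l\<in>pg_lines. card (l \<inter> K) = m)"

definition field_automorphism :: "('a::field \<Rightarrow> 'a) \<Rightarrow> bool" where
  "field_automorphism s \<longleftrightarrow>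
     bij s \<and> (\<forall>x y. s (x + y) = s x + s y) \<and> (\<forall>x y. s (x * y) = s x * s y)"

definition semilinear_bijection :: "('a::field ^ 3 \<Rightarrow> 'a ^ 3) \<Rightarrow> bool" where
  "semilinear_bijection g \<longleftrightarrow>
     bij g \<and> (\<forall>u v. g (u + v) = g u + g v) \<and>
     (\<exists>s. field_automorphism s \<and> (\<forall>c v. g (c *s v) = s c *s g v))"

(* A point is a set of vectors, so a semilinear map acts on points by taking images. *)
definition PGammaL_equivalent :: "('a::field ^ 3) set set \<Rightarrow> ('a ^ 3) set set \<Rightarrow> bool" where
  "PGammaL_equivalent K L \<longleftrightarrow>
     (\<exists>g. semilinear_bijection g \<and> (\<lambda>P. g ` P) ` K = L)"

(* If the field has q^n elements and d divides n, this is its unique subfield of order q^d. *)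
definition subfield_of_order :: "nat \<Rightarrow> 'a::field set" where
  "subfield_of_order m = {c. c ^ m = c}"

definition is_basis_over :: "'a::field set \<Rightarrow> ('a ^ 3) set \<Rightarrow> ('a ^ 3) set \<Rightarrow> bool" where
  "is_basis_over K B V \<longleftrightarrow>
     finite B \<and> B \<subseteq> V \<and>
     (\<forall>c. (\<forall>b\<in>B. c b \<in> K) \<and> (\<Sum>b\<in>B. c b *s b) = 0 \<longrightarrow> (\<forall>b\<in>B. c b = 0)) \<and>
     V = {(\<Sum>b\<in>B. c b *s b) |c. \<forall>b\<in>B. c b \<in> K}"

(* The library's dim is only available when the scalars form a whole type. *)
definition dim_over :: "'a::field set \<Rightarrow> ('a ^ 3) set \<Rightarrow> nat" where
  "dim_over K V = (THE d. \<exists>B. is_basis_over K B V \<and> card B = d)"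

definition q_polynomial :: "nat \<Rightarrow> nat \<Rightarrow> 'a::field poly \<Rightarrow> bool" where
  "q_polynomial q n f \<longleftrightarrow> (\<exists>a. f = (\<Sum>i<n. monom (a i) (q ^ i)))"

definition Tr_poly :: "nat \<Rightarrow> nat \<Rightarrow> 'a::field poly" where
  "Tr_poly q n = (\<Sum>i<n. monom 1 (q ^ i))"

definition max_field_of_linearity_Fq :: "nat \<Rightarrow> nat \<Rightarrow> 'a::field poly \<Rightarrow> bool" where
  "max_field_of_linearity_Fq q n f \<longleftrightarrow>
     \<not> (\<exists>d>1. d dvd n \<and>
          (\<forall>c\<in>subfield_of_order (q ^ d). \<forall>x. poly f (c * x) = c * poly f x))"

definition U_set :: "'a::field poly \<Rightarrow> ('a ^ 3) set" where
  "U_set f = {vector [x, poly f x, 0] |x. True}"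

definition D_set :: "'a::field poly \<Rightarrow> ('a ^ 3) set set" where
  "D_set f = {vec.span {vector [x, poly f x, 0]} |x. x \<noteq> 0}"

definition G_set :: "'a::field poly \<Rightarrow> ('a ^ 3) set set" where
  "G_set f = {vec.span {vector [x, poly f x, 1]} |x. True}"

definition B_set :: "'a::field poly \<Rightarrow> ('a ^ 3) set set" where
  "B_set f = G_set f \<union> D_set f"

definition C_set :: "'a::field poly \<Rightarrow> ('a ^ 3) set set" where
  "C_set f = G_set f \<union> (line_infty - D_set f)"

definition weight :: "nat \<Rightarrow> 'a::field poly \<Rightarrow> ('a ^ 3) set \<Rightarrow> nat" where
  "weight q f P = dim_over (subfield_of_order q) (U_set f \<inter> P)"

definition frequency :: "nat \<Rightarrow> 'a::field poly \<Rightarrow> nat \<Rightarrow> nat" where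
  "frequency q f i = card {P \<in> D_set f. weight q f P = i}"

definition weight_distribution :: "nat \<Rightarrow> 'a::field poly \<Rightarrow> nat list \<Rightarrow> bool" where
  "weight_distribution q f ws \<longleftrightarrow>
     sorted_wrt (<) ws \<and> set ws = weight q f ` D_set f"

definition is_club :: "nat \<Rightarrow> nat \<Rightarrow> 'a::field poly \<Rightarrow> nat \<Rightarrow> bool" where
  "is_club q n f i \<longleftrightarrow>
     1 \<le> i \<and> i < n \<and>
     (\<exists>!P. P \<in> D_set f \<and> weight q f P = i) \<and>
     (\<forall>P\<in>D_set f. weight q f P \<noteq> i \<longrightarrow> weight q f P = 1)"

definition scattered :: "nat \<Rightarrow> 'a::field poly \<Rightarrow> bool" where
  "scattered q f \<longleftrightarrow> (\<forall>P\<in>D_set f. weight q f P = 1)"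

end

theory Submission
  imports Defs
begin

text \<open>
  The lines of \<open>PG(2,q^n)\<close> are \<open>l\<^sub>\<infinity>\<close>, the lines \<open>x = c\<close>, and the lines \<open>y = m x + b\<close>. The last of these
  has as many affine points in common with the graph of \<open>f\<close> as the additive map
  \<open>x \<mapsto> f(x) - m x\<close> has preimages of \<open>b\<close>: either none or \<open>q^w\<close>, where \<open>w\<close> is the weight of the
  point \<open>(1, m, 0)\<close> and is \<open>0\<close> outside \<open>D\<^sub>f\<close>.
  All that remains is to separate the size of \<open>D\<^sub>f\<close> (or of its complement) from the other
  intersection numbers. This needs no bound from the theory of directions: the identity
  \<open>\<Sum>(q^w - 1) = q^n - 1\<close> over the points of \<open>D\<^sub>f\<close>, and the inequality \<open>w + w' \<le> n\<close> for the weights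
  of two distinct points, suffice because there is a point of weight \<open>1\<close>.
  If some weight is \<open>n - 1\<close>, then \<open>f(x) - m x\<close> has an image of \<open>F\<^sub>q\<close>-dimension one and hence is
  \<open>e Tr(b x)\<close>, so that a linear change of coordinates turns the graph of \<open>f\<close> into that of the trace.
\<close>

section \<open>Additive maps on finite fields and dimension over a subfield\<close>

text \<open>A nonempty fibre is the translate of the kernel by any one of its elements.\<close>

lemma additive_fiber:
  fixes h :: "'a::{ab_group_add,finite} \<Rightarrow> 'b::ab_group_add"
  assumes add: "\<And>x y. h (x + y) = h x + h y"
  shows "card {x. h x = b} = (if b \<in> range h then card {x. h x = 0} else 0)"
proof (cases "b \<in> range h")
  case True
  then obtain a where a: "h a = b" by auto
  have sub: "h (x - y) = h x - h y" for x y
    using add[of "x - y" y] by (simp add: algebra_simps)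
  have "bij_betw (\<lambda>x. x + a) {x. h x = 0} {x. h x = b}"
    by (rule bij_betw_byWitness[where f' = "\<lambda>x. x - a"]) (auto simp: add sub a)
  then show ?thesis using True by (simp add: bij_betw_same_card)
next
  case False
  then have "{x. h x = b} = {}" by auto
  then show ?thesis using False by simp
qed

text \<open>The fibres over the range partition the domain, and each has the size of the
  kernel.\<close>

lemma additive_card:
  fixes h :: "'a::{ab_group_add,finite} \<Rightarrow> 'b::ab_group_add"
  assumes add: "\<And>x y. h (x + y) = h x + h y"
  shows "card (range h) * card {x. h x = 0} = CARD('a)"
proof -
  have "CARD('a) = card (\<Union>b\<in>range h. {x. h x = b})"
    by (rule arg_cong[of _ _ card]) auto
  also have "\<dots> = (\<Sum>b\<in>range h. card {x. h x = b})"
    by (rule card_UN_disjoint) auto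
  also have "\<dots> = (\<Sum>b\<in>range h. card {x. h x = 0})"
    by (rule sum.cong) (auto simp: additive_fiber[OF add, of "h x" for x])
  finally show ?thesis by simp
qed

text \<open>Translation by 1 permutes the field, so adding 1 to every element leaves the sum of all
  elements unchanged.\<close>

lemma of_nat_CARD: "of_nat CARD('a) = (0 :: 'a::{field,finite})"
proof -
  have "(\<Sum>y\<in>UNIV. y + (1::'a)) = (\<Sum>y\<in>UNIV. y)"
    by (rule sum.reindex_bij_witness[of _ "\<lambda>y. y - 1" "\<lambda>y. y + 1"]) auto
  then show ?thesis by (simp add: sum.distrib)
qed

text \<open>Multiplication by \<open>x \<noteq> 0\<close> permutes the nonzero elements; comparing
  their products gives Fermat's identity.\<close>

lemma power_CARD: "x ^ CARD('a) = (x :: 'a::{field,finite})"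
proof (cases "x = 0")
  case False
  have "(\<Prod>y\<in>UNIV - {0}. x * y) = (\<Prod>y\<in>UNIV - {0}. y)"
    by (rule prod.reindex_bij_witness[of _ "\<lambda>y. y / x" "\<lambda>y. x * y"]) (use False in auto)
  then have "x ^ (CARD('a) - 1) = 1"
    by (simp add: prod.distrib card_Diff_singleton)
  then have "x * x ^ (CARD('a) - 1) = x" by simp
  moreover have "Suc (CARD('a) - 1) = CARD('a)"
    by (simp add: card_gt_0_iff)
  ultimately show ?thesis
    by (metis power_Suc)
qed (simp add: card_gt_0_iff power_0_left)

section \<open>Bases and dimension over a subset of scalars\<close>

text \<open>Vectors of \<open>V\<close> correspond to coefficient functions from \<open>B\<close> to
  \<open>K\<close>, taken extensional so that each is counted once. Injectivity is independence
  applied to the difference of two such functions.\<close>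

lemma card_basis_over:
  fixes V :: "('a::{field,finite} ^ 3) set"
  assumes diff: "\<And>a b. a \<in> K \<Longrightarrow> b \<in> K \<Longrightarrow> a - b \<in> K"
    and B: "is_basis_over K B V"
  shows "card V = card K ^ card B"
proof -
  define g where "g = (\<lambda>c. \<Sum>b\<in>B. c b *s b)"
  have indep: "\<forall>b\<in>B. c b = 0" if "\<forall>b\<in>B. c b \<in> K" "g c = 0" for c
    using B that unfolding is_basis_over_def g_def by blast
  have V: "V = {g c |c. \<forall>b\<in>B. c b \<in> K}"
    using B unfolding is_basis_over_def g_def by blast
  have "inj_on g (PiE B (\<lambda>_. K))"
  proof (rule inj_onI)
    fix c d assume c: "c \<in> PiE B (\<lambda>_. K)" and d: "d \<in> PiE B (\<lambda>_. K)" and "g c = g d"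
    then have "g (\<lambda>b. c b - d b) = 0"
      by (simp add: g_def vec.scale_left_diff_distrib sum_subtractf)
    moreover have "\<forall>b\<in>B. c b - d b \<in> K"
      using c d diff by (auto simp: PiE_iff)
    ultimately have "\<forall>b\<in>B. c b - d b = 0" using indep[of "\<lambda>b. c b - d b"] by blast
    then show "c = d" using c d by (intro PiE_ext) auto
  qed
  moreover have "g ` PiE B (\<lambda>_. K) = V"
  proof -
    have "g c \<in> g ` PiE B (\<lambda>_. K)" if "\<forall>b\<in>B. c b \<in> K" for c
    proof -
      have "g c = g (restrict c B)" by (simp add: g_def)
      then show ?thesis using that by (intro image_eqI[of _ _ "restrict c B"]) auto
    qed
    then show ?thesis unfolding V by (auto simp: PiE_iff)
  qed
  ultimately have "card V = card (PiE B (\<lambda>_. K))"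
    by (metis card_image)
  then show ?thesis by (simp add: card_PiE)
qed

text \<open>An independent subset of \<open>V\<close> of greatest cardinality spans: adjoining a
  further vector gives a relation in which that vector has a nonzero coefficient, so it can be
  solved for.\<close>

lemma basis_over_exists:
  fixes V :: "('a::{field,finite} ^ 3) set"
  assumes K: "0 \<in> K" "1 \<in> K" "\<And>a b. a \<in> K \<Longrightarrow> b \<in> K \<Longrightarrow> a - b \<in> K"
      "\<And>a b. a \<in> K \<Longrightarrow> b \<in> K \<Longrightarrow> a / b \<in> K"
    and V: "0 \<in> V" "\<And>u v. u \<in> V \<Longrightarrow> v \<in> V \<Longrightarrow> u + v \<in> V"
      "\<And>c v. c \<in> K \<Longrightarrow> v \<in> V \<Longrightarrow> c *s v \<in> V"
  shows "\<exists>B. is_basis_over K B V"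
proof -
  define ind where "ind = (\<lambda>B :: ('a ^ 3) set. \<forall>c. (\<forall>b\<in>B. c b \<in> K) \<and> (\<Sum>b\<in>B. c b *s b) = 0 \<longrightarrow> (\<forall>b\<in>B. c b = 0))"
  have "{} \<subseteq> V \<and> ind {}" by (simp add: ind_def)
  \<comment> \<open>The maximum exists because cardinalities of subsets of a finite space are
    bounded.\<close>
  then obtain B where B: "B \<subseteq> V" "ind B"
    and max: "\<And>B'. B' \<subseteq> V \<Longrightarrow> ind B' \<Longrightarrow> card B' \<le> card B"
    using ex_has_greatest_nat[of "\<lambda>B. B \<subseteq> V \<and> ind B" "{}" card "Suc CARD('a ^ 3)"]
    by (metis (mono_tags, lifting) card_mono finite_class.finite_UNIV less_Suc_eq_le subset_UNIV)
  have comb: "(\<Sum>b\<in>B. c b *s b) \<in> V" if "\<forall>b\<in>B. c b \<in> K" for c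
  proof -
    have "\<forall>b\<in>B'. b \<in> V \<and> c b \<in> K \<Longrightarrow> (\<Sum>b\<in>B'. c b *s b) \<in> V" if "finite B'" for B'
      using that by (induction B') (use V in auto)
    from this[of B] that B(1) show ?thesis by auto
  qed
  have "v \<in> {(\<Sum>b\<in>B. c b *s b) |c. \<forall>b\<in>B. c b \<in> K}" if v: "v \<in> V" for v
  proof (cases "v \<in> B")
    case True
    have "(\<Sum>b\<in>B. (if b = v then 1 else 0) *s b) = v"
      using True by (simp add: if_distrib[of "\<lambda>c. c *s _"] cong: if_cong)
    moreover have "\<forall>b\<in>B. (if b = v then 1 else 0) \<in> K"
      using K by simp
    ultimately show ?thesis by (intro CollectI exI[of _ "\<lambda>b. if b = v then 1 else 0"]) simp
  next
    case False
    then have "card (insert v B) > card B" by simp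
    then have "\<not> ind (insert v B)" using max[of "insert v B"] B v by auto
    then obtain c where c: "\<forall>b\<in>insert v B. c b \<in> K" "(\<Sum>b\<in>insert v B. c b *s b) = 0"
      and nz: "\<exists>b\<in>insert v B. c b \<noteq> 0"
      unfolding ind_def by blast
    have sum: "c v *s v + (\<Sum>b\<in>B. c b *s b) = 0" using c(2) False by simp
    have "c v \<noteq> 0"
    proof
      assume "c v = 0"
      then have "\<forall>b\<in>B. c b = 0" using sum c(1) B(2) unfolding ind_def by auto
      then show False using nz \<open>c v = 0\<close> by auto
    qed
    have "v = (- 1 / c v) *s (\<Sum>b\<in>B. c b *s b)"
    proof -
      have "(\<Sum>b\<in>B. c b *s b) = - (c v *s v)"
        using sum by (simp add: eq_neg_iff_add_eq_0 add.commute)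
      then show ?thesis using \<open>c v \<noteq> 0\<close>
        by (simp add: vec_eq_iff)
    qed
    also have "\<dots> = (\<Sum>b\<in>B. (- c b / c v) *s b)"
      by (simp add: vec.scale_sum_right)
    finally have "v = (\<Sum>b\<in>B. (- c b / c v) *s b)" .
    moreover have "\<forall>b\<in>B. - c b / c v \<in> K"
      using K(4)[OF K(3)[OF K(1)]] c(1) by simp
    ultimately show ?thesis by (intro CollectI exI[of _ "\<lambda>b. - c b / c v"]) simp
  qed
  then have "V = {(\<Sum>b\<in>B. c b *s b) |c. \<forall>b\<in>B. c b \<in> K}"
    using comb by auto
  then have "is_basis_over K B V"
    using B unfolding is_basis_over_def ind_def by simp
  then show ?thesis ..
qed

text \<open>All bases have equal size, because \<open>card K ^ card B\<close> is fixed by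
  \<open>V\<close> and \<open>card K > 1\<close>. Hence the definite description in
  \<open>dim_over\<close> denotes that size.\<close>

lemma card_dim_over:
  fixes V :: "('a::{field,finite} ^ 3) set"
  assumes K: "0 \<in> K" "1 \<in> K" "\<And>a b. a \<in> K \<Longrightarrow> b \<in> K \<Longrightarrow> a - b \<in> K"
      "\<And>a b. a \<in> K \<Longrightarrow> b \<in> K \<Longrightarrow> a / b \<in> K"
    and V: "0 \<in> V" "\<And>u v. u \<in> V \<Longrightarrow> v \<in> V \<Longrightarrow> u + v \<in> V"
      "\<And>c v. c \<in> K \<Longrightarrow> v \<in> V \<Longrightarrow> c *s v \<in> V"
  shows "card V = card K ^ dim_over K V"
proof -
  obtain B where B: "is_basis_over K B V"
    using basis_over_exists[OF assms] by blast
  have "card {0, 1 :: 'a} \<le> card K"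
    using K by (intro card_mono) auto
  then have "card K > 1" by simp
  then have "d = card B" if "\<exists>B'. is_basis_over K B' V \<and> card B' = d" for d
    using that card_basis_over[OF K(3) B] card_basis_over[OF K(3)]
    by (metis power_inject_exp)
  then have "dim_over K V = card B"
    unfolding dim_over_def using B by (intro the_equality) blast+
  then show ?thesis using card_basis_over[OF K(3) B] by simp
qed

section \<open>Points and lines of the projective plane\<close>

text \<open>The point at infinity shared by all lines of slope \<open>m\<close>.\<close>

definition slope_point :: "'a::field \<Rightarrow> ('a ^ 3) set" where
  "slope_point m = vec.span {vector [1, m, 0]}"

definition vertical_point :: "('a::field ^ 3) set" where
  "vertical_point = vec.span {vector [0, 1, 0]}"

definition affine_point :: "'a::field \<Rightarrow> 'a \<Rightarrow> ('a ^ 3) set" where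
  "affine_point x y = vec.span {vector [x, y, 1]}"

text \<open>The affine line \<open>y = m x + b\<close>, homogenised by the third coordinate.\<close>

definition slope_line :: "'a::field \<Rightarrow> 'a \<Rightarrow> ('a ^ 3) set set" where
  "slope_line m b = points_in {v. v $ 2 = m * v $ 1 + b * v $ 3}"

definition vertical_line :: "'a::field \<Rightarrow> ('a ^ 3) set set" where
  "vertical_line c = points_in {v. v $ 1 = c * v $ 3}"

lemma vector_3_eq_iff: "(v :: 'a::zero ^ 3) = w \<longleftrightarrow> v $ 1 = w $ 1 \<and> v $ 2 = w $ 2 \<and> v $ 3 = w $ 3"
  by (simp add: vec_eq_iff forall_3)

lemma in_span_singleton_iff: "u \<in> vec.span {v} \<longleftrightarrow> (\<exists>k. u = k *s v)"
  by (auto simp: vec.span_singleton)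

lemma span_singleton_subset_iff:
  "vec.subspace W \<Longrightarrow> vec.span {v} \<subseteq> W \<longleftrightarrow> v \<in> W"
  using vec.span_minimal[of "{v}" W] vec.span_base[of v "{v}"] by auto

lemma span_singleton_eq_iff:
  assumes "v \<noteq> 0"
  shows "vec.span {u} = vec.span {v} \<longleftrightarrow> (\<exists>k. k \<noteq> 0 \<and> u = k *s v)"
proof
  assume eq: "vec.span {u} = vec.span {v}"
  then have "u \<in> vec.span {v}" using vec.span_base[of u "{u}"] by auto
  then obtain k where k: "u = k *s v" by (auto simp: in_span_singleton_iff)
  have "v \<in> vec.span {u}" unfolding eq by (simp add: vec.span_base)
  then obtain l where "v = l *s u" by (auto simp: in_span_singleton_iff)
  then show "\<exists>k. k \<noteq> 0 \<and> u = k *s v" using k assms by auto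
next
  assume "\<exists>k. k \<noteq> 0 \<and> u = k *s v"
  then obtain k where k: "k \<noteq> 0" "u = k *s v" by blast
  have "v = inverse k *s u" using k by simp
  then show "vec.span {u} = vec.span {v}"
    using k by (metis in_span_singleton_iff span_singleton_subset_iff subset_antisym vec.subspace_span)
qed

lemma slope_point_altdef: "x \<noteq> 0 \<Longrightarrow> vec.span {vector [x, y, 0]} = slope_point (y / x)"
  unfolding slope_point_def
  by (subst span_singleton_eq_iff) (auto simp: vector_3_eq_iff intro!: exI[of _ x])

lemma slope_point_inject [simp]: "slope_point m = slope_point m' \<longleftrightarrow> m = m'"
  unfolding slope_point_def
  by (subst span_singleton_eq_iff) (auto simp: vector_3_eq_iff)

lemma affine_point_inject [simp]: "affine_point x y = affine_point x' y' \<longleftrightarrow> x = x' \<and> y = y'"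
  unfolding affine_point_def
  by (subst span_singleton_eq_iff) (auto simp: vector_3_eq_iff)

lemma point_distinct [simp]:
  "slope_point m \<noteq> vertical_point" "vertical_point \<noteq> slope_point m"
  "affine_point x y \<noteq> vertical_point" "vertical_point \<noteq> affine_point x y"
  "affine_point x y \<noteq> slope_point m" "slope_point m \<noteq> affine_point x y"
  unfolding slope_point_def vertical_point_def affine_point_def
  by (subst span_singleton_eq_iff; auto simp: vector_3_eq_iff)+

text \<open>A representative is normalised by its third coordinate if that is nonzero, otherwise by
  the first, otherwise by the second.\<close>

lemma pg_points_cases:
  assumes "P \<in> pg_points"
  obtains (slope) m where "P = slope_point m" | (vertical) "P = vertical_point"
    | (affine) x y where "P = affine_point x y"
proof -
  obtain v where v: "v \<noteq> 0" "P = vec.span {v}"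
    using assms by (auto simp: pg_points_def)
  consider "v $ 3 \<noteq> 0" | "v $ 3 = 0" "v $ 1 \<noteq> 0" | "v $ 3 = 0" "v $ 1 = 0" "v $ 2 \<noteq> 0"
    using v(1) by (auto simp: vector_3_eq_iff)
  then show thesis
  proof cases
    case 1
    then have "P = affine_point (v $ 1 / v $ 3) (v $ 2 / v $ 3)"
      unfolding v(2) affine_point_def
      by (subst span_singleton_eq_iff) (auto simp: vector_3_eq_iff intro!: exI[of _ "v $ 3"])
    then show thesis by (rule affine)
  next
    case 2
    then have "P = slope_point (v $ 2 / v $ 1)"
      unfolding v(2) slope_point_def
      by (subst span_singleton_eq_iff) (auto simp: vector_3_eq_iff intro!: exI[of _ "v $ 1"])
    then show thesis by (rule slope)
  next
    case 3
    then have "P = vertical_point"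
      unfolding v(2) vertical_point_def
      by (subst span_singleton_eq_iff) (auto simp: vector_3_eq_iff intro!: exI[of _ "v $ 2"])
    then show thesis by (rule vertical)
  qed
qed

lemma span_in_points_in:
  "vec.subspace W \<Longrightarrow> v \<noteq> 0 \<Longrightarrow> vec.span {v} \<in> points_in W \<longleftrightarrow> v \<in> W"
  by (auto simp: points_in_def pg_points_def span_singleton_subset_iff)

lemma subspace_line_infty: "vec.subspace {v :: 'a::field ^ 3. v $ 3 = 0}"
  and subspace_slope_line: "vec.subspace {v :: 'a::field ^ 3. v $ 2 = m * v $ 1 + b * v $ 3}"
  and subspace_vertical_line: "vec.subspace {v :: 'a::field ^ 3. v $ 1 = c * v $ 3}"
  by (auto simp: vec.subspace_def algebra_simps)

lemma nonzero_vectors: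
  "vector [1, m, 0] \<noteq> (0 :: 'a::field ^ 3)" "vector [0, 1, 0] \<noteq> (0 :: 'a::field ^ 3)"
  "vector [x, y, 1] \<noteq> (0 :: 'a::field ^ 3)"
  by (auto simp: vector_3_eq_iff)

lemma in_line_infty [simp]:
  "slope_point m \<in> line_infty" "vertical_point \<in> line_infty" "affine_point x y \<notin> line_infty"
  unfolding line_infty_def slope_point_def vertical_point_def affine_point_def
  by (subst span_in_points_in[OF subspace_line_infty nonzero_vectors(1)]
      span_in_points_in[OF subspace_line_infty nonzero_vectors(2)]
      span_in_points_in[OF subspace_line_infty nonzero_vectors(3)]; simp)+

lemma in_slope_line [simp]:
  "slope_point m' \<in> slope_line m b \<longleftrightarrow> m' = m"
  "vertical_point \<notin> slope_line m b"
  "affine_point x y \<in> slope_line m b \<longleftrightarrow> y = m * x + b"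
  unfolding slope_line_def slope_point_def vertical_point_def affine_point_def
  by (subst span_in_points_in[OF subspace_slope_line nonzero_vectors(1)]
      span_in_points_in[OF subspace_slope_line nonzero_vectors(2)]
      span_in_points_in[OF subspace_slope_line nonzero_vectors(3)]; simp)+

lemma in_vertical_line [simp]:
  "slope_point m' \<notin> vertical_line c"
  "vertical_point \<in> vertical_line c"
  "affine_point x y \<in> vertical_line c \<longleftrightarrow> x = c"
  unfolding vertical_line_def slope_point_def vertical_point_def affine_point_def
  by (subst span_in_points_in[OF subspace_vertical_line nonzero_vectors(1)]
      span_in_points_in[OF subspace_vertical_line nonzero_vectors(2)]
      span_in_points_in[OF subspace_vertical_line nonzero_vectors(3)]; simp)+

lemma line_infty_eq: "(line_infty :: ('a::field ^ 3) set set) = insert vertical_point (range slope_point)"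
proof (intro set_eqI iffI)
  fix P :: "('a ^ 3) set" assume P: "P \<in> line_infty"
  then have "P \<in> pg_points" by (simp add: line_infty_def points_in_def)
  then show "P \<in> insert vertical_point (range slope_point)"
    by (cases rule: pg_points_cases) (use P in auto)
qed auto

section \<open>Planes through the origin and the list of all lines\<close>

lemma dim_span_pair:
  fixes u v :: "'a::field ^ 3"
  assumes "v \<noteq> 0" "u \<notin> vec.span {v}"
  shows "vec.dim (vec.span {u, v}) = 2"
proof -
  have "vec.independent {u, v}" using assms by (simp add: vec.independent_insert)
  then have "vec.dim (vec.span {u, v}) = card {u, v}"
    by (rule vec.dim_span_eq_card_independent)
  moreover have "u \<noteq> v" using assms(2) vec.span_base[of u "{v}"] by auto
  ultimately show ?thesis by (metis card_2_iff)
qed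

lemma dim_plane:
  fixes u v :: "'a::field ^ 3"
  assumes "vec.subspace W" "u \<in> W" "v \<in> W" "v \<noteq> 0" "u \<notin> vec.span {v}"
    and "\<And>w. w \<in> W \<Longrightarrow> \<exists>a b. w = a *s u + b *s v"
  shows "vec.dim W = 2"
proof -
  have "vec.span {u, v} = W"
  proof
    show "vec.span {u, v} \<subseteq> W" using assms by (intro vec.span_minimal) auto
    show "W \<subseteq> vec.span {u, v}"
    proof
      fix w assume "w \<in> W"
      then obtain a b where "w = a *s u + b *s v" using assms(6) by blast
      then show "w \<in> vec.span {u, v}"
        by (simp add: vec.span_add vec.span_base vec.span_scale)
    qed
  qed
  then show ?thesis using dim_span_pair[of v u] assms by simp
qed

lemma dim_line_infty: "vec.dim {v :: 'a::field ^ 3. v $ 3 = 0} = 2"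
proof (rule dim_plane[OF subspace_line_infty])
  show "\<exists>a b. w = a *s vector [1, 0, 0] + b *s vector [0, 1, 0]"
    if "w \<in> {v. v $ 3 = 0}" for w :: "'a ^ 3"
    using that by (intro exI[of _ "w $ 1"] exI[of _ "w $ 2"]) (auto simp: vector_3_eq_iff)
qed (auto simp: in_span_singleton_iff vector_3_eq_iff)

lemma dim_slope_line: "vec.dim {v :: 'a::field ^ 3. v $ 2 = m * v $ 1 + b * v $ 3} = 2"
proof (rule dim_plane[OF subspace_slope_line])
  show "\<exists>a c. w = a *s vector [1, m, 0] + c *s vector [0, b, 1]"
    if "w \<in> {v. v $ 2 = m * v $ 1 + b * v $ 3}" for w :: "'a ^ 3"
    using that by (intro exI[of _ "w $ 1"] exI[of _ "w $ 3"]) (auto simp: vector_3_eq_iff)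
qed (auto simp: in_span_singleton_iff vector_3_eq_iff)

lemma dim_vertical_line: "vec.dim {v :: 'a::field ^ 3. v $ 1 = c * v $ 3} = 2"
proof (rule dim_plane[OF subspace_vertical_line])
  show "\<exists>a b. w = a *s vector [c, 0, 1] + b *s vector [0, 1, 0]"
    if "w \<in> {v. v $ 1 = c * v $ 3}" for w :: "'a ^ 3"
    using that by (intro exI[of _ "w $ 3"] exI[of _ "w $ 2"]) (auto simp: vector_3_eq_iff)
qed (auto simp: in_span_singleton_iff vector_3_eq_iff)

text \<open>A plane not inside \<open>x3 = 0\<close> contains some \<open>u\<close> with third
  coordinate 1 and some \<open>v \<noteq> 0\<close> with third coordinate 0. Whether
  \<open>v $ 1\<close> vanishes decides between vertical line and slope. One inclusion suffices,
  since both planes have dimension 2.\<close>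

lemma plane_cases:
  fixes W :: "('a::field ^ 3) set"
  assumes W: "vec.subspace W" and dim: "vec.dim W = 2"
  shows "W = {v. v $ 3 = 0} \<or> (\<exists>c. W = {v. v $ 1 = c * v $ 3}) \<or>
    (\<exists>m b. W = {v. v $ 2 = m * v $ 1 + b * v $ 3})"
proof (cases "W \<subseteq> {v. v $ 3 = 0}")
  case True
  then show ?thesis
    using vec.subspace_dim_equal[OF W subspace_line_infty] dim dim_line_infty[where 'a = 'a] by auto
next
  case False
  then obtain u0 where u0: "u0 \<in> W" "u0 $ 3 \<noteq> 0" by auto
  define u where "u = inverse (u0 $ 3) *s u0"
  have u: "u \<in> W" "u $ 3 = 1" using u0 W by (auto simp: u_def vec.subspace_scale)
  have "\<not> W \<subseteq> vec.span {u}"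
  proof
    assume "W \<subseteq> vec.span {u}"
    then have "vec.dim W \<le> vec.dim (vec.span {u})" by (rule vec.dim_subset)
    also have "\<dots> \<le> 1" by (simp add: vec.dim_span)
    finally show False using dim by simp
  qed
  then obtain v0 where v0: "v0 \<in> W" "v0 \<notin> vec.span {u}" by auto
  \<comment> \<open>Subtracting this multiple of \<open>u\<close> clears the third coordinate; the
    result is nonzero because \<open>v0\<close> is no multiple of \<open>u\<close>.\<close>
  define v where "v = v0 - (v0 $ 3) *s u"
  have v: "v \<in> W" "v $ 3 = 0"
    using v0 u W by (auto simp: v_def vec.subspace_diff vec.subspace_scale)
  have "v \<noteq> 0" using v0(2) by (auto simp: v_def in_span_singleton_iff)
  have comb: "a *s u + b *s v \<in> W" for a b
    using u v W by (simp add: vec.subspace_add vec.subspace_scale)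
  show ?thesis
  proof (cases "v $ 1 = 0")
    case True
    then have v2: "v $ 2 \<noteq> 0" using \<open>v \<noteq> 0\<close> v by (auto simp: vector_3_eq_iff)
    have "{w. w $ 1 = u $ 1 * w $ 3} \<subseteq> W"
    proof clarify
      fix w :: "'a ^ 3" assume "w $ 1 = u $ 1 * w $ 3"
      then have "w = (w $ 3) *s u + ((w $ 2 - w $ 3 * u $ 2) / v $ 2) *s v"
        using u v v2 True by (simp add: vector_3_eq_iff)
      then show "w \<in> W" by (metis comb)
    qed
    then have "W = {w. w $ 1 = u $ 1 * w $ 3}"
      by (intro vec.subspace_dim_equal[OF subspace_vertical_line W, symmetric])
        (simp_all add: dim dim_vertical_line)
    then show ?thesis by blast
  next
    case False
    define m where "m = v $ 2 / v $ 1"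
    define b where "b = u $ 2 - m * u $ 1"
    have "{w. w $ 2 = m * w $ 1 + b * w $ 3} \<subseteq> W"
    proof clarify
      fix w :: "'a ^ 3" assume "w $ 2 = m * w $ 1 + b * w $ 3"
      then have "w = (w $ 3) *s u + ((w $ 1 - w $ 3 * u $ 1) / v $ 1) *s v"
        using u v False by (simp add: vector_3_eq_iff m_def b_def field_simps)
      then show "w \<in> W" by (metis comb)
    qed
    then have "W = {w. w $ 2 = m * w $ 1 + b * w $ 3}"
      by (intro vec.subspace_dim_equal[OF subspace_slope_line W, symmetric])
        (simp_all add: dim dim_slope_line)
    then show ?thesis by blast
  qed
qed

lemma pg_lines_eq:
  "(pg_lines :: ('a::field ^ 3) set set set) =
     insert line_infty (range vertical_line \<union> range (\<lambda>(m, b). slope_line m b))"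
proof (intro subset_antisym subsetI)
  fix l :: "('a ^ 3) set set" assume "l \<in> pg_lines"
  then obtain W where "l = points_in W" "vec.subspace W" "vec.dim W = 2"
    by (auto simp: pg_lines_def)
  then show "l \<in> insert line_infty (range vertical_line \<union> range (\<lambda>(m, b). slope_line m b))"
    using plane_cases[of W] by (fastforce simp: line_infty_def vertical_line_def slope_line_def)
next
  fix l :: "('a ^ 3) set set"
  assume "l \<in> insert line_infty (range vertical_line \<union> range (\<lambda>(m, b). slope_line m b))"
  then show "l \<in> pg_lines"
    using subspace_line_infty dim_line_infty subspace_vertical_line dim_vertical_line
      subspace_slope_line dim_slope_line
    by (fastforce simp: pg_lines_def line_infty_def vertical_line_def slope_line_def)
qed

lemma slope_line_inject [simp]: "slope_line m b = slope_line m' b' \<longleftrightarrow> m = m' \<and> b = b'"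
proof
  assume eq: "slope_line m b = slope_line m' b'"
  have "slope_point m \<in> slope_line m' b'" "affine_point 0 b \<in> slope_line m' b'"
    unfolding eq[symmetric] by simp_all
  then show "m = m' \<and> b = b'" by simp
qed auto

text \<open>Turns each claim about types into an equation of sets, where repeated list entries do no
  harm.\<close>

lemma of_type_iff: "of_type K ms \<longleftrightarrow> set ms = intersection_numbers K"
  unfolding of_type_def intersection_numbers_def by auto

section \<open>The Frobenius map and the trace\<close>

locale field_extension =
  fixes q n :: nat and ty :: "'a::{field,finite} itself"
  assumes primepow_q: "primepow q" and n_ge_2: "n \<ge> 2" and card_field: "CARD('a) = q ^ n"
begin

lemma q_ge_2: "q \<ge> 2"
  using primepow_gt_Suc_0[OF primepow_q] by simp

text \<open>The characteristic is a prime dividing the field size \<open>q ^ n\<close>, a power of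
  the prime below \<open>q\<close>. This makes raising to the power \<open>q ^ j\<close>
  additive.\<close>

lemma frobenius_exponent: obtains k where "prime CHAR('a)" "q = CHAR('a) ^ k"
proof -
  obtain p k where p: "prime p" "q = p ^ k"
    using primepow_q by (auto simp: primepow_def)
  have char: "prime CHAR('a)"
    by (intro prime_CHAR_semidom finite_imp_CHAR_pos) simp
  have "CHAR('a) dvd p ^ (k * n)"
    using of_nat_CARD[where 'a = 'a] p
    by (simp add: of_nat_eq_0_iff_char_dvd card_field power_mult del: of_nat_power)
  then have "CHAR('a) = p"
    using char p(1) prime_dvd_power primes_dvd_imp_eq by blast
  then show thesis using that char p(2) by blast
qed

lemma frobenius_sum: "(\<Sum>i\<in>A. g i :: 'a) ^ q ^ j = (\<Sum>i\<in>A. g i ^ q ^ j)"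
proof -
  obtain k where "prime CHAR('a)" "q = CHAR('a) ^ k" by (rule frobenius_exponent)
  then show ?thesis
    by (intro freshmans_dream_sum'[of _ "k * j"]) (simp_all add: power_mult)
qed

lemma frobenius_add: "(x + y :: 'a) ^ q ^ j = x ^ q ^ j + y ^ q ^ j"
proof -
  obtain k where "prime CHAR('a)" "q = CHAR('a) ^ k" by (rule frobenius_exponent)
  then show ?thesis
    by (intro freshmans_dream'[of _ "k * j"]) (simp_all add: power_mult)
qed

lemma frobenius_diff: "(x - y :: 'a) ^ q ^ j = x ^ q ^ j - y ^ q ^ j"
  using frobenius_add[of "x - y" y j] by (simp add: algebra_simps)

abbreviation Fq :: "'a set" where "Fq \<equiv> subfield_of_order q"

lemma subfield_closed:
  "0 \<in> Fq" "1 \<in> Fq" "a \<in> Fq \<Longrightarrow> b \<in> Fq \<Longrightarrow> a - b \<in> Fq"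
  "a \<in> Fq \<Longrightarrow> b \<in> Fq \<Longrightarrow> a / b \<in> Fq"
  using q_ge_2 frobenius_diff[of a b 1]
  by (auto simp: subfield_of_order_def power_divide power_0_left)

lemma subfield_power: "c \<in> Fq \<Longrightarrow> c ^ q ^ i = c"
  by (induction i) (simp_all add: subfield_of_order_def power_mult)

abbreviation trace :: "'a \<Rightarrow> 'a" where "trace x \<equiv> (\<Sum>i<n. x ^ q ^ i)"

text \<open>The exponents \<open>q ^ i\<close> are pairwise distinct because
  \<open>q \<ge> 2\<close>.\<close>

lemma coeff_q_poly:
  "j < n \<Longrightarrow> coeff (\<Sum>i<n. monom (c i :: 'a) (q ^ i)) (q ^ j) = c j"
  using q_ge_2 by (simp add: coeff_sum cong: if_cong)

lemma degree_q_poly: "degree (\<Sum>i<n. monom (c i :: 'a) (q ^ i)) \<le> q ^ (n - 1)"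
proof (rule degree_sum_le)
  fix i assume "i \<in> {..<n}"
  then have "q ^ i \<le> q ^ (n - 1)" using q_ge_2 by (intro power_increasing) auto
  then show "degree (monom (c i) (q ^ i)) \<le> q ^ (n - 1)"
    using degree_monom_le order_trans by blast
qed simp

lemma poly_q_poly: "poly (\<Sum>i<n. monom (c i) (q ^ i)) x = (\<Sum>i<n. c i * x ^ q ^ i)"
  for x :: "'b::comm_ring_1"
  by (simp add: poly_sum poly_monom)

lemma power_q_n: "(x :: 'a) ^ q ^ n = x"
  using power_CARD[of x] by (simp add: card_field)

text \<open>Upper bound: the elements are roots of \<open>X^q - X\<close>. Lower bound: they form
  the kernel of the additive map \<open>x^q - x\<close>, whose image lies in the at most
  \<open>q ^ (n - 1)\<close> zeros of the trace.\<close>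

lemma card_subfield: "card Fq = q"
proof (rule antisym)
  define P where "P = (monom 1 q - monom 1 1 :: 'a poly)"
  have "coeff P q = 1" using q_ge_2 by (simp add: P_def)
  then have "P \<noteq> 0" by auto
  moreover have "degree P \<le> q"
    unfolding P_def using q_ge_2
    by (intro degree_diff_le) (auto intro: order_trans[OF degree_monom_le])
  moreover have "Fq = {x. poly P x = 0}"
    by (auto simp: subfield_of_order_def P_def poly_monom)
  ultimately show "card Fq \<le> q" using card_poly_roots_bound[of P] by simp
next
  define h where "h = (\<lambda>x :: 'a. x ^ q - x)"
  have "trace (h x) = 0" for x
  proof -
    \<comment> \<open>The sum telescopes to \<open>x ^ q ^ n - x\<close>, which vanishes on the
      field.\<close>
    have "trace (h x) = (\<Sum>i<n. x ^ q ^ Suc i - x ^ q ^ i)"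
      by (simp add: h_def frobenius_diff flip: power_mult)
    also have "\<dots> = x ^ q ^ n - x ^ q ^ 0" by (rule sum_lessThan_telescope)
    finally show ?thesis by (simp add: power_q_n)
  qed
  then have "range h \<subseteq> {x. poly (\<Sum>i<n. monom 1 (q ^ i)) x = 0}"
    by (auto simp: poly_q_poly)
  then have "card (range h) \<le> card {x :: 'a. poly (\<Sum>i<n. monom 1 (q ^ i)) x = 0}"
    by (intro card_mono) auto
  also have "\<dots> \<le> q ^ (n - 1)"
  proof (rule order_trans[OF card_poly_roots_bound degree_q_poly])
    show "(\<Sum>i<n. monom (1 :: 'a) (q ^ i)) \<noteq> 0"
      using coeff_q_poly[of 0 "\<lambda>_. 1"] n_ge_2 by force
  qed
  finally have "card (range h) * card Fq \<le> q ^ (n - 1) * card Fq" by simp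
  moreover have "card (range h) * card Fq = q ^ n"
    using additive_card[of h] frobenius_add[of _ _ 1]
    by (simp add: h_def subfield_of_order_def card_field)
  moreover have "q ^ n = q ^ (n - 1) * q"
    using n_ge_2 by (cases n) simp_all
  ultimately show "q \<le> card Fq" using q_ge_2 by simp
qed

text \<open>The condition \<open>g(x)^q = g(x)\<close> is an identity between polynomials of degree less than
  \<open>q^n\<close> once \<open>x^(q^n)\<close> is replaced by \<open>x\<close>, so it holds coefficientwise.\<close>
lemma subfield_valued_eq_trace:
  assumes "\<And>x. (\<Sum>i<n. c i * x ^ q ^ i) \<in> Fq"
  shows "(\<Sum>i<n. c i * x ^ q ^ i) = trace (c 0 * x)"
proof -
  \<comment> \<open>Coefficients of the \<open>q\<close>-th power: each index moves up by one, and
    index \<open>n\<close> wraps round to 0.\<close>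
  define d where "d = (\<lambda>i. (if i = 0 then c (n - 1) else c (i - 1)) ^ q)"
  obtain n' where n': "n = Suc n'" using n_ge_2 by (cases n) auto
  have "(\<Sum>i<n. monom (c i) (q ^ i)) = (\<Sum>i<n. monom (d i) (q ^ i))"
  proof (rule poly_eqI_degree[of UNIV])
    fix x :: 'a
    have "(\<Sum>i<n. c i * x ^ q ^ i) = (\<Sum>i<n. c i * x ^ q ^ i) ^ q ^ 1"
      using assms[of x] by (simp add: subfield_of_order_def)
    also have "\<dots> = (\<Sum>i<n. c i ^ q * x ^ q ^ Suc i)"
      unfolding frobenius_sum by (simp add: power_mult_distrib mult.commute flip: power_mult)
    also have "\<dots> = c n' ^ q * x ^ q ^ n + (\<Sum>i<n'. c i ^ q * x ^ q ^ Suc i)"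
      by (simp add: n')
    also have "\<dots> = (\<Sum>i<n. d i * x ^ q ^ i)"
      unfolding power_q_n by (simp add: n' sum.lessThan_Suc_shift d_def del: sum.lessThan_Suc)
    finally show "poly (\<Sum>i<n. monom (c i) (q ^ i)) x = poly (\<Sum>i<n. monom (d i) (q ^ i)) x"
      by (simp add: poly_q_poly)
  next
    have "q ^ (n - 1) < q ^ n" using q_ge_2 n_ge_2 by (intro power_strict_increasing) auto
    then show "degree (\<Sum>i<n. monom (c i) (q ^ i)) < CARD('a)"
        "degree (\<Sum>i<n. monom (d i) (q ^ i)) < CARD('a)"
      using degree_q_poly[of c] degree_q_poly[of d] by (simp_all add: card_field)
  qed
  then have cd: "c i = d i" if "i < n" for i
    using coeff_q_poly[OF that, of c] coeff_q_poly[OF that, of d] by simp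
  have c: "c i = c 0 ^ q ^ i" if "i < n" for i
    using that
  proof (induction i)
    case (Suc i)
    then have "c (Suc i) = c i ^ q" using cd[of "Suc i"] by (simp add: d_def)
    then show ?case using Suc by (simp add: mult.commute flip: power_mult)
  qed simp
  show ?thesis
  proof (rule sum.cong)
    fix i assume "i \<in> {..<n}"
    then have "c i = c 0 ^ q ^ i" by (intro c) simp
    then show "c i * x ^ q ^ i = (c 0 * x) ^ q ^ i" by (simp only: power_mult_distrib)
  qed simp
qed

end

section \<open>Linear sets and intersections with lines\<close>

locale linear_set = field_extension q n ty for q n and ty :: "'a::{field,finite} itself" +
  fixes f :: "'a poly"
  assumes q_poly: "q_polynomial q n f"
begin

lemma poly_f: obtains a where "\<And>x. poly f x = (\<Sum>i<n. a i * x ^ q ^ i)"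
  using q_poly by (auto simp: q_polynomial_def poly_q_poly)

lemma f_add: "poly f (x + y) = poly f x + poly f y"
proof -
  obtain a where "\<And>x. poly f x = (\<Sum>i<n. a i * x ^ q ^ i)" using poly_f by blast
  then show ?thesis by (simp add: frobenius_add distrib_left sum.distrib)
qed

lemma f_0 [simp]: "poly f 0 = 0"
  using f_add[of 0 0] by (metis add.right_neutral add_left_cancel)

lemma f_scale: "c \<in> Fq \<Longrightarrow> poly f (c * x) = c * poly f x"
proof -
  obtain a where "\<And>x. poly f x = (\<Sum>i<n. a i * x ^ q ^ i)" using poly_f by blast
  moreover assume "c \<in> Fq"
  ultimately show ?thesis
    by (simp add: power_mult_distrib subfield_power sum_distrib_left mult.left_commute)
qed

text \<open>The first coordinates of the vectors in
  \<open>U_set f \<inter> slope_point m\<close>.\<close>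

definition ker :: "'a \<Rightarrow> 'a set" where
  "ker m = {x. poly f x = m * x}"

text \<open>The intercepts \<open>b\<close> for which \<open>slope_line m b\<close> contains an
  affine point of the graph.\<close>

definition im :: "'a \<Rightarrow> 'a set" where
  "im m = range (\<lambda>x. poly f x - m * x)"

definition slopes :: "'a set" where
  "slopes = {m. \<exists>x. x \<noteq> 0 \<and> poly f x = m * x}"

text \<open>Taken for every \<open>m\<close>, with value 0 outside \<open>slopes\<close>, so that
  lines of all slopes are treated by one formula.\<close>

definition w :: "'a \<Rightarrow> nat" where
  "w m = weight q f (slope_point m)"

text \<open>Dividing by the nonzero first coordinate gives slope \<open>f(x) / x\<close>; so
  \<open>vertical_point\<close> never occurs.\<close>

lemma D_set_eq: "D_set f = slope_point ` slopes"
proof (intro set_eqI iffI)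
  fix P assume "P \<in> D_set f"
  then obtain x where x: "x \<noteq> 0" "P = vec.span {vector [x, poly f x, 0]}"
    by (auto simp: D_set_def)
  then have "P = slope_point (poly f x / x)" by (simp add: slope_point_altdef)
  moreover have "poly f x / x \<in> slopes" using x by (auto simp: slopes_def)
  ultimately show "P \<in> slope_point ` slopes" by blast
next
  fix P assume "P \<in> slope_point ` slopes"
  then obtain m x where m: "P = slope_point m" "x \<noteq> 0" "poly f x = m * x"
    by (auto simp: slopes_def)
  then have "P = vec.span {vector [x, poly f x, 0]}"
    by (simp add: slope_point_altdef del: vector_3)
  then show "P \<in> D_set f" using m(2) by (auto simp: D_set_def)
qed

lemma card_D_set: "card (D_set f) = card slopes"
  unfolding D_set_eq by (intro card_image inj_onI) simp

lemma weights_D_set: "weight q f ` D_set f = w ` slopes"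
  by (auto simp: D_set_eq w_def)

text \<open>Passes from the dimension in \<open>weight\<close> to counting:
  \<open>x \<mapsto> (x, m x, 0)\<close> maps \<open>ker m\<close> bijectively onto the
  \<open>Fq\<close>-space whose dimension is the weight.\<close>

lemma card_ker: "card (ker m) = q ^ w m"
proof -
  define V where "V = U_set f \<inter> slope_point m"
  have V: "V = (\<lambda>x. vector [x, m * x, 0]) ` ker m"
    unfolding V_def U_set_def slope_point_def ker_def
    by (auto simp: in_span_singleton_iff vector_3_eq_iff)
  have "card V = card Fq ^ dim_over Fq V"
  proof (rule card_dim_over[OF subfield_closed])
    have "0 \<in> ker m" by (simp add: ker_def)
    then show "0 \<in> V" unfolding V by (auto simp: vector_3_eq_iff image_iff)
    fix u v assume "u \<in> V" "v \<in> V"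
    then obtain x y where "x \<in> ker m" "u = vector [x, m * x, 0]" "y \<in> ker m" "v = vector [y, m * y, 0]"
      unfolding V by blast
    then show "u + v \<in> V" unfolding V
      by (intro image_eqI[of _ _ "x + y"]) (auto simp: vector_3_eq_iff ker_def f_add algebra_simps)
  next
    fix c v assume "c \<in> Fq" "v \<in> V"
    then obtain x where "x \<in> ker m" "v = vector [x, m * x, 0]"
      unfolding V by blast
    then show "c *s v \<in> V" unfolding V using \<open>c \<in> Fq\<close>
      by (intro image_eqI[of _ _ "c * x"]) (auto simp: vector_3_eq_iff ker_def f_scale)
  qed
  moreover have "card V = card (ker m)"
    unfolding V by (intro card_image inj_onI) (simp add: vector_3_eq_iff)
  ultimately show ?thesis
    by (simp add: w_def weight_def V_def card_subfield)
qed

lemma shifted_add: "poly f (x + y) - m * (x + y) = (poly f x - m * x) + (poly f y - m * y)"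
  by (simp add: f_add algebra_simps)

lemma card_im_ker: "card (im m) * q ^ w m = q ^ n"
  using additive_card[of "\<lambda>x. poly f x - m * x", OF shifted_add]
  by (simp add: im_def card_field ker_def flip: card_ker)

lemma card_fiber: "card {x. poly f x = m * x + b} = (if b \<in> im m then q ^ w m else 0)"
  using additive_fiber[of "\<lambda>x. poly f x - m * x" b, OF shifted_add]
  by (simp add: im_def ker_def algebra_simps flip: card_ker)

lemma w_le_n: "w m \<le> n"
proof (rule ccontr)
  assume "\<not> w m \<le> n"
  then have "q ^ n < q ^ w m" using q_ge_2 by (intro power_strict_increasing) auto
  moreover have "q ^ w m dvd q ^ n" using card_im_ker[of m] by (metis dvd_triv_right)
  ultimately show False using q_ge_2 by (auto dest: dvd_imp_le)
qed

lemma card_im: "card (im m) = q ^ (n - w m)"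
proof -
  have "card (im m) * q ^ w m = q ^ (n - w m) * q ^ w m"
    using card_im_ker[of m] w_le_n[of m] by (simp flip: power_add)
  then show ?thesis using q_ge_2 by simp
qed

lemma slopes_iff: "m \<in> slopes \<longleftrightarrow> w m > 0"
proof
  assume "m \<in> slopes"
  then obtain x where "x \<noteq> 0" "{0, x} \<subseteq> ker m" by (auto simp: slopes_def ker_def)
  then have "2 \<le> q ^ w m"
    using card_mono[of "ker m" "{0, x}"] by (simp add: card_ker)
  then show "w m > 0" by (cases "w m") auto
next
  assume "w m > 0"
  then have "q ^ 0 < q ^ w m" using q_ge_2 by (intro power_strict_increasing) auto
  then have "card (ker m) > 1" by (simp only: card_ker power_0)
  moreover have "card (ker m) \<le> card {0 :: 'a}" if "ker m \<subseteq> {0}"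
    using that by (intro card_mono) auto
  ultimately have "\<not> ker m \<subseteq> {0}" by auto
  then show "m \<in> slopes" by (auto simp: slopes_def ker_def)
qed

text \<open>Each nonzero \<open>x\<close> lies in exactly one kernel, that of
  \<open>m = f(x) / x\<close>.\<close>

lemma sum_weights: "(\<Sum>m\<in>slopes. q ^ w m - 1) = q ^ n - 1"
proof -
  have "UNIV - {0} = (\<Union>m\<in>slopes. ker m - {0})"
  proof (intro set_eqI iffI)
    fix x :: 'a assume "x \<in> UNIV - {0}"
    then have "x \<noteq> 0" "poly f x = poly f x / x * x" by auto
    then show "x \<in> (\<Union>m\<in>slopes. ker m - {0})" unfolding slopes_def ker_def by blast
  qed auto
  then have "card (UNIV - {0 :: 'a}) = card (\<Union>m\<in>slopes. ker m - {0})"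
    by (rule arg_cong)
  also have "\<dots> = (\<Sum>m\<in>slopes. card (ker m - {0}))"
    by (rule card_UN_disjoint) (auto simp: ker_def)
  also have "\<dots> = (\<Sum>m\<in>slopes. q ^ w m - 1)"
  proof (intro sum.cong refl)
    fix m
    have "0 \<in> ker m" by (simp add: ker_def)
    then show "card (ker m - {0}) = q ^ w m - 1"
      by (simp only: card_Diff_singleton card_ker)
  qed
  finally show ?thesis by (simp add: card_Diff_singleton card_field)
qed

text \<open>Kernels of distinct slopes meet only in 0, so addition embeds their product into the
  field.\<close>

lemma weight_sum_le:
  assumes "m \<noteq> m'"
  shows "w m + w m' \<le> n"
proof -
  have "inj_on (\<lambda>(x, y). x + y) (ker m \<times> ker m')"
  proof (rule inj_onI, clarify)
    fix x y x' y' assume *: "x \<in> ker m" "y \<in> ker m'" "x' \<in> ker m" "y' \<in> ker m'"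
      and eq: "x + y = x' + y'"
    have d: "x - x' = y' - y" using eq by (simp add: algebra_simps)
    \<comment> \<open>The common difference lies in both kernels.\<close>
    have "poly f (x - x') = m * (x - x')" "poly f (y' - y) = m' * (y' - y)"
      using * f_add[of "x - x'" x'] f_add[of "y' - y" y] by (auto simp: ker_def algebra_simps)
    then have "x - x' = 0" using assms d by auto
    then show "x = x' \<and> y = y'" using eq by auto
  qed
  then have "card (ker m \<times> ker m') \<le> CARD('a)"
    by (rule card_inj_on_le) auto
  then have "q ^ (w m + w m') \<le> q ^ n"
    by (simp add: card_cartesian_product card_ker card_field power_add)
  then show ?thesis using q_ge_2 by (simp add: power_le_imp_le_exp)
qed

lemma finite_slopes [simp]: "finite slopes" by simp

text \<open>Removing \<open>m\<close> from the weight sum leaves \<open>q^w(m) * (q^(n-w(m)) - 1)\<close>, and each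
  remaining term is at most \<open>q^(n-w(m)) - 1\<close>; so with exactly \<open>q^w(m)\<close> terms all are extremal.\<close>
lemma card_slopes_extremal:
  assumes "m \<in> slopes" "card slopes = q ^ w m + 1" "m' \<in> slopes" "m' \<noteq> m"
  shows "w m' = n - w m"
proof (rule ccontr)
  assume neq: "w m' \<noteq> n - w m"
  let ?A = "slopes - {m}"
  have le: "w k \<le> n - w m" if "k \<noteq> m" for k
    using weight_sum_le[OF that] by simp
  have "(\<Sum>k\<in>?A. q ^ w k - 1) < (\<Sum>k\<in>?A. q ^ (n - w m) - 1)"
  proof (rule sum_strict_mono_ex1)
    show "\<forall>k\<in>?A. q ^ w k - 1 \<le> q ^ (n - w m) - 1"
      using le q_ge_2 by (auto intro!: diff_le_mono power_increasing)
    have "w m' < n - w m" using le[OF assms(4)] neq by simp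
    then have "q ^ w m' < q ^ (n - w m)" using q_ge_2 by (intro power_strict_increasing) auto
    moreover have "0 < q ^ w m'" using q_ge_2 by simp
    ultimately have "q ^ w m' - 1 < q ^ (n - w m) - 1" by linarith
    then show "\<exists>k\<in>?A. q ^ w k - 1 < q ^ (n - w m) - 1" using assms by blast
  qed simp
  also have "\<dots> = q ^ w m * (q ^ (n - w m) - 1)"
    using assms by (simp add: card_Diff_singleton)
  also have "\<dots> = q ^ n - q ^ w m"
    using w_le_n[of m] by (simp add: right_diff_distrib' flip: power_add)
  finally have "(\<Sum>k\<in>?A. q ^ w k - 1) < q ^ n - q ^ w m" .
  moreover have "(\<Sum>k\<in>?A. q ^ w k - 1) + (q ^ w m - 1) = q ^ n - 1"
    using sum_weights sum.remove[OF finite_slopes assms(1), of "\<lambda>k. q ^ w k - 1"] by simp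
  moreover have "0 < q ^ w m" using q_ge_2 by simp
  ultimately show False by linarith
qed

text \<open>Every term of \<open>sum_weights\<close> is at least \<open>q - 1\<close>.\<close>

lemma card_slopes_bound: "(q - 1) * card slopes \<le> q ^ n - 1"
proof -
  have "q - 1 \<le> q ^ w m - 1" if "m \<in> slopes" for m
    using that q_ge_2 slopes_iff[of m] self_le_power[of q "w m"] by (intro diff_le_mono) auto
  then have "(\<Sum>m\<in>slopes. q - 1) \<le> (\<Sum>m\<in>slopes. q ^ w m - 1)" by (intro sum_mono)
  then show ?thesis unfolding sum_weights by (simp add: mult.commute)
qed

section \<open>Sizes of the intersections with single lines\<close>

lemma card_slope_line_B:
  "card (slope_line m b \<inter> B_set f) = card {x. poly f x = m * x + b} + (if m \<in> slopes then 1 else 0)"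
proof -
  have "slope_line m b \<inter> B_set f = (\<lambda>x. affine_point x (poly f x)) ` {x. poly f x = m * x + b}
      \<union> (if m \<in> slopes then {slope_point m} else {})"
    by (auto simp: B_set_def G_set_def D_set_eq simp flip: affine_point_def)
  then show ?thesis
    by (simp add: card_Un_disjoint card_image inj_on_def image_iff)
qed

text \<open>Passing to the complement of \<open>D_set f\<close> at infinity reverses the
  contribution of \<open>slope_point m\<close>.\<close>

lemma card_slope_line_C:
  "card (slope_line m b \<inter> C_set f) = card {x. poly f x = m * x + b} + (if m \<in> slopes then 0 else 1)"
proof -
  have "slope_line m b \<inter> C_set f = (\<lambda>x. affine_point x (poly f x)) ` {x. poly f x = m * x + b}
      \<union> (if m \<in> slopes then {} else {slope_point m})"
    by (auto simp: C_set_def G_set_def D_set_eq line_infty_eq simp flip: affine_point_def)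
  then show ?thesis
    by (simp add: card_Un_disjoint card_image inj_on_def image_iff)
qed

lemma card_vertical_line_B: "card (vertical_line c \<inter> B_set f) = 1"
proof -
  have "vertical_line c \<inter> B_set f = {affine_point c (poly f c)}"
    by (auto simp: B_set_def G_set_def D_set_eq simp flip: affine_point_def)
  then show ?thesis by simp
qed

lemma card_vertical_line_C: "card (vertical_line c \<inter> C_set f) = 2"
proof -
  have "vertical_line c \<inter> C_set f = {affine_point c (poly f c), vertical_point}"
    by (auto simp: C_set_def G_set_def D_set_eq line_infty_eq simp flip: affine_point_def)
  then show ?thesis by simp
qed

lemma card_line_infty_B: "card (line_infty \<inter> B_set f) = card slopes"
proof -
  have "line_infty \<inter> B_set f = D_set f"
    by (auto simp: B_set_def G_set_def D_set_eq simp flip: affine_point_def)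
  then show ?thesis by (simp add: card_D_set)
qed

lemma card_line_infty_C: "card (line_infty \<inter> C_set f) = q ^ n + 1 - card slopes"
proof -
  have "line_infty \<inter> C_set f = line_infty - D_set f"
    by (auto simp: C_set_def G_set_def simp flip: affine_point_def)
  moreover have "D_set f \<subseteq> line_infty" by (auto simp: D_set_eq)
  ultimately have "card (line_infty \<inter> C_set f) = card (line_infty :: ('a ^ 3) set set) - card slopes"
    by (simp add: card_Diff_subset card_D_set)
  moreover have "card (line_infty :: ('a ^ 3) set set) = q ^ n + 1"
    unfolding line_infty_eq by (subst card_insert_disjoint) (auto simp: card_image inj_on_def card_field)
  ultimately show ?thesis by simp
qed

lemma intersection_numbers_lines:
  "intersection_numbers K = insert (card (line_infty \<inter> K))
     (range (\<lambda>c. card (vertical_line c \<inter> K)) \<union> range (\<lambda>(m, b). card (slope_line m b \<inter> K)))"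
  for K :: "('a ^ 3) set set"
  unfolding intersection_numbers_def pg_lines_eq by (auto simp: image_iff split: prod.splits)

lemma w_0: "m \<notin> slopes \<Longrightarrow> w m = 0"
  by (simp add: slopes_iff)

lemma zero_in_im: "0 \<in> im m"
  unfolding im_def by (rule image_eqI[of _ _ 0]) simp_all

lemma im_UNIV: "m \<notin> slopes \<Longrightarrow> b \<in> im m"
proof -
  assume "m \<notin> slopes"
  then have "card (im m) = CARD('a)" by (simp add: card_im w_0 card_field)
  then have "im m = UNIV" by (intro card_eq_UNIV_imp_eq_UNIV) auto
  then show ?thesis by simp
qed

text \<open>A nontrivial kernel prevents surjectivity. The missing intercept provides a line
  disjoint from \<open>C_set f\<close>.\<close>

lemma im_proper: "m \<in> slopes \<Longrightarrow> \<exists>b. b \<notin> im m"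
proof (rule ccontr)
  assume "m \<in> slopes" and "\<nexists>b. b \<notin> im m"
  then have "im m = UNIV" by auto
  then have "q ^ (n - w m) = q ^ n" by (metis card_field card_im)
  then show False using q_ge_2 \<open>m \<in> slopes\<close> n_ge_2 by (simp add: slopes_iff)
qed

text \<open>A line of slope outside \<open>slopes\<close> has one affine point and none at infinity.
  For \<open>m\<close> in \<open>slopes\<close> there are \<open>q ^ w m\<close> affine points or
  none, plus the point at infinity.\<close>

lemma intersection_numbers_B:
  "intersection_numbers (B_set f) = {1, card slopes} \<union> (\<lambda>m. q ^ w m + 1) ` slopes"
proof -
  define R where "R = range (\<lambda>(m, b). card (slope_line m b \<inter> B_set f))"
  have "R \<subseteq> insert 1 ((\<lambda>m. q ^ w m + 1) ` slopes)"
    unfolding R_def by (auto simp: card_slope_line_B card_fiber w_0 im_UNIV)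
  moreover have "q ^ w m + 1 \<in> R" if "m \<in> slopes" for m
    using that zero_in_im[of m] unfolding R_def
    by (intro image_eqI[of _ _ "(m, 0)"]) (auto simp: card_slope_line_B card_fiber)
  ultimately show ?thesis
    unfolding intersection_numbers_lines card_vertical_line_B card_line_infty_B R_def[symmetric] by auto
qed

text \<open>The value 2 comes from vertical lines and from slopes outside \<open>slopes\<close>; 0
  comes from a slope in \<open>slopes\<close> with intercept outside the image.\<close>

lemma intersection_numbers_C:
  assumes "slopes \<noteq> {}"
  shows "intersection_numbers (C_set f) =
    {0, 2, q ^ n + 1 - card slopes} \<union> (\<lambda>m. q ^ w m) ` slopes"
proof -
  define R where "R = range (\<lambda>(m, b). card (slope_line m b \<inter> C_set f))"
  have "R \<subseteq> {0, 2} \<union> (\<lambda>m. q ^ w m) ` slopes"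
    unfolding R_def by (auto simp: card_slope_line_C card_fiber w_0 im_UNIV split: if_splits)
  moreover have "q ^ w m \<in> R" if "m \<in> slopes" for m
    using that zero_in_im[of m] unfolding R_def
    by (intro image_eqI[of _ _ "(m, 0)"]) (auto simp: card_slope_line_C card_fiber)
  moreover have "0 \<in> R"
  proof -
    obtain m where m: "m \<in> slopes" using assms by auto
    then obtain b where "b \<notin> im m" using im_proper by blast
    with m show ?thesis
      unfolding R_def by (intro image_eqI[of _ _ "(m, b)"]) (auto simp: card_slope_line_C card_fiber)
  qed
  ultimately show ?thesis
    unfolding intersection_numbers_lines card_vertical_line_C card_line_infty_C R_def[symmetric] by auto
qed

section \<open>Counting lines with a given intersection number\<close>

lemma frequency_eq: "frequency q f i = card {m \<in> slopes. w m = i}"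
proof -
  have "{P \<in> D_set f. weight q f P = i} = slope_point ` {m \<in> slopes. w m = i}"
    by (auto simp: D_set_eq w_def)
  then show ?thesis by (simp add: frequency_def card_image inj_on_def)
qed

text \<open>Through each point of weight \<open>i\<close> there is one line for each of the
  \<open>q ^ (n - i)\<close> intercepts in the image.\<close>

lemma card_slope_lines:
  "card ((\<lambda>(m, b). slope_line m b) ` (SIGMA m:{m \<in> slopes. w m = i}. im m)) =
     q ^ (n - i) * frequency q f i"
proof -
  have "card ((\<lambda>(m, b). slope_line m b) ` (SIGMA m:{m \<in> slopes. w m = i}. im m)) =
      card (SIGMA m:{m \<in> slopes. w m = i}. im m)"
    by (rule card_image) (auto simp: inj_on_def)
  also have "\<dots> = (\<Sum>m\<in>{m \<in> slopes. w m = i}. card (im m))"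
    by (rule card_SigmaI) auto
  also have "\<dots> = (\<Sum>m\<in>{m \<in> slopes. w m = i}. q ^ (n - i))"
    by (intro sum.cong) (auto simp: card_im)
  finally show ?thesis by (simp add: frequency_eq mult.commute)
qed

lemma power_q_eq_iff [simp]: "q ^ i = q ^ j \<longleftrightarrow> i = j"
  using q_ge_2 by simp

text \<open>The inequality for \<open>card slopes\<close> keeps the line at infinity out of the
  count.\<close>

lemma lines_B:
  assumes "i > 0" "card slopes \<noteq> q ^ i + 1"
  shows "card {l \<in> pg_lines. card (l \<inter> B_set f) = q ^ i + 1} = q ^ (n - i) * frequency q f i"
proof -
  have "slope_line m b \<in> (\<lambda>(m, b). slope_line m b) ` (SIGMA m:{m \<in> slopes. w m = i}. im m)
      \<longleftrightarrow> card (slope_line m b \<inter> B_set f) = q ^ i + 1" for m b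
    using assms(1) q_ge_2
    by (auto simp: card_slope_line_B card_fiber w_0 im_UNIV image_iff)
  moreover have "vertical_line c \<noteq> slope_line m b" "line_infty \<noteq> slope_line m b" for c m b :: 'a
    by (metis in_vertical_line(2) in_slope_line(2), metis in_line_infty(2) in_slope_line(2))
  ultimately have "{l \<in> pg_lines. card (l \<inter> B_set f) = q ^ i + 1} =
      (\<lambda>(m, b). slope_line m b) ` (SIGMA m:{m \<in> slopes. w m = i}. im m)"
    unfolding pg_lines_eq using assms q_ge_2
    by (auto simp: card_vertical_line_B card_line_infty_B)
  then show ?thesis by (simp add: card_slope_lines)
qed

text \<open>From \<open>q > 2\<close> follows \<open>q ^ i > 2\<close>, which separates these lines
  from the vertical ones and from those of slope outside \<open>slopes\<close>, all meeting
  \<open>C_set f\<close> in two points.\<close>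

lemma lines_C:
  assumes "i > 0" "q > 2" "q ^ n + 1 - card slopes \<noteq> q ^ i"
  shows "card {l \<in> pg_lines. card (l \<inter> C_set f) = q ^ i} = q ^ (n - i) * frequency q f i"
proof -
  have gt: "q ^ i > 2" using assms self_le_power[of q i] by simp
  have "slope_line m b \<in> (\<lambda>(m, b). slope_line m b) ` (SIGMA m:{m \<in> slopes. w m = i}. im m)
      \<longleftrightarrow> card (slope_line m b \<inter> C_set f) = q ^ i" for m b
    using gt q_ge_2
    by (auto simp: card_slope_line_C card_fiber w_0 im_UNIV image_iff)
  moreover have "vertical_line c \<noteq> slope_line m b" "line_infty \<noteq> slope_line m b" for c m b :: 'a
    by (metis in_vertical_line(2) in_slope_line(2), metis in_line_infty(2) in_slope_line(2))
  ultimately have "{l \<in> pg_lines. card (l \<inter> C_set f) = q ^ i} =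
      (\<lambda>(m, b). slope_line m b) ` (SIGMA m:{m \<in> slopes. w m = i}. im m)"
    unfolding pg_lines_eq using assms gt
    by (auto simp: card_vertical_line_C card_line_infty_C)
  then show ?thesis by (simp add: card_slope_lines)
qed

end

section \<open>A point of weight \<open>n - 1\<close> and equivalence with the trace\<close>

context linear_set
begin

text \<open>The image is closed under scalars from \<open>Fq\<close> and has \<open>q\<close>
  elements, as many as there are \<open>Fq\<close>-multiples of \<open>e\<close>.\<close>

lemma im_eq_multiples:
  assumes "w m = n - 1" "e \<in> im m" "e \<noteq> 0"
  shows "im m = (\<lambda>c. c * e) ` Fq"
proof (rule sym, rule card_subset_eq)
  show "(\<lambda>c. c * e) ` Fq \<subseteq> im m"
  proof clarify
    fix c assume c: "c \<in> Fq"
    obtain x where x: "e = poly f x - m * x" using assms(2) by (auto simp: im_def)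
    have "c * e = poly f (c * x) - m * (c * x)"
      unfolding x using c by (simp add: f_scale algebra_simps)
    then show "c * e \<in> im m" by (auto simp: im_def)
  qed
  have "card ((\<lambda>c. c * e) ` Fq) = card Fq"
    using assms(3) by (intro card_image) (auto simp: inj_on_def)
  moreover have "n - (n - 1) = 1" using n_ge_2 by simp
  ultimately show "card ((\<lambda>c. c * e) ` Fq) = card (im m)"
    by (simp add: card_subfield card_im assms(1))
qed simp

text \<open>After division by a nonzero element \<open>e\<close> of the image,
  \<open>f(x) - m x\<close> takes values in \<open>Fq\<close>, so
  \<open>subfield_valued_eq_trace\<close> applies.\<close>

lemma trace_form:
  assumes "w m = n - 1"
  obtains b e where "b \<noteq> 0" "e \<noteq> 0" "\<And>x. poly f x - m * x = e * trace (b * x)"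
proof -
  obtain a where a: "\<And>x. poly f x = (\<Sum>i<n. a i * x ^ q ^ i)" using poly_f by blast
  have "card (im m) = q ^ 1"
    unfolding card_im assms using n_ge_2 by (intro arg_cong[of _ _ "(^) q"]) simp
  then have "\<not> im m \<subseteq> {0}"
    using q_ge_2 card_mono[of "{0}" "im m"] by auto
  then obtain e where e: "e \<in> im m" "e \<noteq> 0" by auto
  \<comment> \<open>Coefficients of \<open>(f(x) - m x) / e\<close>; the term \<open>m x\<close>
    affects index 0 only.\<close>
  define c where "c = (\<lambda>i. (a i - (if i = 0 then m else 0)) / e)"
  have c: "(\<Sum>i<n. c i * x ^ q ^ i) = (poly f x - m * x) / e" for x
  proof -
    have "(\<Sum>i<n. c i * x ^ q ^ i) =
        (\<Sum>i<n. a i * x ^ q ^ i - (if i = 0 then m * x else 0)) / e"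
      unfolding sum_divide_distrib by (intro sum.cong) (auto simp: c_def diff_divide_distrib left_diff_distrib)
    also have "\<dots> = (poly f x - m * x) / e"
      using n_ge_2 by (simp add: sum_subtractf a)
    finally show ?thesis .
  qed
  have "(\<Sum>i<n. c i * x ^ q ^ i) \<in> Fq" for x
  proof -
    have "poly f x - m * x \<in> im m" by (auto simp: im_def)
    then show ?thesis unfolding c im_eq_multiples[OF assms e] using e(2) by auto
  qed
  then have "(\<Sum>i<n. c i * x ^ q ^ i) = trace (c 0 * x)" for x
    by (rule subfield_valued_eq_trace)
  then have tr: "poly f x - m * x = e * trace (c 0 * x)" for x
    using c[of x] e(2) by (simp add: field_simps)
  \<comment> \<open>Otherwise the image would be zero, although it contains
    \<open>e\<close>.\<close>
  have "c 0 \<noteq> 0"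
  proof
    assume "c 0 = 0"
    then have "poly f x - m * x = 0" for x
      unfolding tr using q_ge_2 by (simp add: power_0_left)
    then show False using e by (auto simp: im_def)
  qed
  then show thesis using that e(2) tr by blast
qed

lemma poly_Tr: "poly (Tr_poly q n) x = trace x"
  by (simp add: Tr_poly_def poly_q_poly)

lemma PGammaL_equivalent_trace:
  assumes "w m = n - 1"
  shows "PGammaL_equivalent (B_set f) (B_set (Tr_poly q n))"
proof -
  obtain b e where be: "b \<noteq> 0" "e \<noteq> 0" and tr: "\<And>x. poly f x - m * x = e * trace (b * x)"
    using trace_form[OF assms] by blast
  \<comment> \<open>Chosen so that \<open>(x, f(x), z)\<close> goes to
    \<open>(b x, Tr(b x), z)\<close>, which treats affine points and points at infinity
    alike.\<close>
  define g :: "'a ^ 3 \<Rightarrow> 'a ^ 3"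
    where "g = (\<lambda>v. vector [b * v $ 1, (v $ 2 - m * v $ 1) / e, v $ 3])"
  have scale: "g (c *s v) = c *s g v" for c v
    by (simp add: g_def vector_3_eq_iff algebra_simps diff_divide_distrib)
  have "bij g"
    by (rule o_bij[of "\<lambda>v. vector [v $ 1 / b, e * v $ 2 + m * v $ 1 / b, v $ 3]"])
      (use be in \<open>auto simp: fun_eq_iff g_def vector_3_eq_iff\<close>)
  moreover have "g (u + v) = g u + g v" for u v
    by (simp add: g_def vector_3_eq_iff algebra_simps add_divide_distrib diff_divide_distrib)
  moreover have "field_automorphism (\<lambda>c :: 'a. c)"
    by (simp add: field_automorphism_def bij_def inj_def)
  ultimately have "semilinear_bijection g"
    unfolding semilinear_bijection_def using scale by blast
  moreover have "(\<lambda>P. g ` P) ` B_set f = B_set (Tr_poly q n)"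
  proof -
    have point: "g ` vec.span {vector [x, poly f x, z]} =
        vec.span {vector [b * x, poly (Tr_poly q n) (b * x), z]}" for x z
    proof -
      have "g (vector [x, poly f x, z]) = vector [b * x, poly (Tr_poly q n) (b * x), z]"
        using be by (simp add: g_def vector_3_eq_iff poly_Tr tr)
      then show ?thesis
        unfolding vec.span_singleton image_image scale by simp
    qed
    have G: "G_set h = (\<lambda>x. vec.span {vector [x, poly h x, 1]}) ` UNIV"
      and D: "D_set h = (\<lambda>x. vec.span {vector [x, poly h x, 0]}) ` (UNIV - {0})" for h :: "'a poly"
      by (auto simp: G_set_def D_set_def)
    have surj: "range ((*) b) = UNIV"
      using be(1) by (intro surjI[of _ "\<lambda>x. x / b"]) simp
    moreover have "inj ((*) b)" using be(1) by (simp add: inj_def)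
    \<comment> \<open>As \<open>x\<close> runs over the field or its nonzero elements, so does
      \<open>b x\<close>; this removes \<open>b\<close> from the parametrisation.\<close>
    ultimately have "(*) b ` (UNIV - {0}) = UNIV - {0}"
      by (simp add: image_set_diff)
    note this surj
    then have "range (\<lambda>x. vec.span {vector [b * x, poly h (b * x), 1]}) = G_set h"
      "(\<lambda>x. vec.span {vector [b * x, poly h (b * x), 0]}) ` (UNIV - {0}) = D_set h"
      for h :: "'a poly"
      using image_image[of "\<lambda>x. vec.span {vector [x, poly h x, 1]}" "(*) b" UNIV, symmetric]
        image_image[of "\<lambda>x. vec.span {vector [x, poly h x, 0]}" "(*) b" "UNIV - {0}", symmetric]
      by (simp_all only: G D)
    then show ?thesis
      unfolding B_set_def image_Un G[of f] D[of f] image_image point by simp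
  qed
  ultimately show ?thesis unfolding PGammaL_equivalent_def by blast
qed

end

section \<open>Weight distributions containing 1\<close>

locale weighted_linear_set = linear_set q n ty f
  for q n and ty :: "'a::{field,finite} itself" and f +
  fixes js :: "nat list"
  assumes distribution: "weight_distribution q f (1 # js)"
begin

lemma weights: "w ` slopes = set (1 # js)"
  using distribution by (simp add: weight_distribution_def weights_D_set)

lemma sorted_weights: "sorted_wrt (<) (1 # js)"
  using distribution by (simp add: weight_distribution_def)

lemma card_weights: "card (set (1 # js)) = length (1 # js)"
  using sorted_weights by (intro distinct_card) (simp add: strict_sorted_iff del: sorted_wrt.simps)

lemma weight_le_last: "i \<in> set (1 # js) \<Longrightarrow> i \<le> last (1 # js)"
proof -
  assume i: "i \<in> set (1 # js)"
  define xs where "xs = 1 # js"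
  have "sorted xs" using sorted_weights by (simp add: strict_sorted_iff xs_def del: sorted_wrt.simps)
  moreover have "xs \<noteq> []" by (simp add: xs_def)
  moreover have "i \<in> set xs" using i by (simp add: xs_def)
  ultimately have "i \<le> last xs"
    by (metis in_set_conv_nth last_conv_nth length_greater_0_conv Suc_pred' less_Suc_eq_le
        lessI sorted_nth_mono)
  then show ?thesis by (simp only: xs_def)
qed

lemma weight_one: obtains m where "m \<in> slopes" "w m = 1"
proof -
  have "1 \<in> w ` slopes" unfolding weights by simp
  then show thesis using that by (metis imageE)
qed

text \<open>A lone point would have weight 1, giving \<open>q - 1 = q ^ n - 1\<close>. So there is a
  second point, of positive weight, and \<open>weight_sum_le\<close> applies.\<close>

lemma weight_less: assumes "m \<in> slopes" shows "w m \<le> n - 1"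
proof -
  obtain m1 where m1: "m1 \<in> slopes" "w m1 = 1" by (rule weight_one)
  have "slopes \<noteq> {m}"
  proof
    assume S: "slopes = {m}"
    then have "q ^ 1 - 1 = q ^ n - 1" using sum_weights m1 by simp
    moreover have "q ^ 1 < q ^ n" using q_ge_2 n_ge_2 by (intro power_strict_increasing) auto
    ultimately show False using q_ge_2 by simp
  qed
  then obtain m' where "m' \<in> slopes" "m' \<noteq> m" using assms by auto
  then show ?thesis using weight_sum_le[of m' m] slopes_iff[of m'] by auto
qed

lemma weight_range: "i \<in> set (1 # js) \<Longrightarrow> 1 \<le> i \<and> i \<le> n - 1"
  unfolding weights[symmetric] using weight_less slopes_iff by fastforce

lemma intersection_numbers_B':
  "intersection_numbers (B_set f) = {1, card (D_set f)} \<union> (\<lambda>i. q ^ i + 1) ` set (1 # js)"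
  unfolding intersection_numbers_B weights[symmetric] card_D_set by (simp add: image_image)

lemma intersection_numbers_C':
  "intersection_numbers (C_set f) = {0, 2, q ^ n + 1 - card (D_set f)} \<union> (\<lambda>i. q ^ i) ` set (1 # js)"
proof -
  have "slopes \<noteq> {}" using weight_one by blast
  then show ?thesis
    unfolding intersection_numbers_C[OF \<open>slopes \<noteq> {}\<close>] weights[symmetric] card_D_set
    by (simp add: image_image)
qed

text \<open>Equality would give all points other than \<open>m\<close> weight
  \<open>n - w m\<close>. If \<open>w m = 1\<close>, two of them have weights summing to
  \<open>2 (n - 1) > n\<close>; otherwise a point of weight 1 is among them, forcing
  \<open>w m = n - 1\<close>.\<close>

lemma card_D_ne:
  assumes "last (1 # js) < n - 1" "i \<in> set (1 # js)"
  shows "card (D_set f) \<noteq> q ^ i + 1"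
proof
  assume "card (D_set f) = q ^ i + 1"
  moreover obtain m where m: "m \<in> slopes" "i = w m"
    using assms(2) unfolding weights[symmetric] by blast
  ultimately have card: "card slopes = q ^ w m + 1" by (simp add: card_D_set)
  have lt: "w m < n - 1" using weight_le_last[OF assms(2)] assms(1) m by simp
  show False
  proof (cases "w m = 1")
    case True
    have "card (slopes - {m}) = q" using card m True by simp
    then obtain T where "T \<subseteq> slopes - {m}" "card T = 2"
      using q_ge_2 obtain_subset_with_card_n by metis
    then obtain k k' where k: "k \<in> slopes - {m}" "k' \<in> slopes - {m}" "k \<noteq> k'"
      by (auto simp: card_2_iff)
    then have "w k = n - 1" "w k' = n - 1"
      using card_slopes_extremal[OF m(1) card] True by auto
    then show False using weight_sum_le[OF k(3)] lt True by linarith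
  next
    case False
    obtain m1 where m1: "m1 \<in> slopes" "w m1 = 1" by (rule weight_one)
    then have "w m1 = n - w m"
      using False by (intro card_slopes_extremal[OF m(1) card]) auto
    then show False using m1 lt by simp
  qed
qed

lemma card_D_ne_1: "last (1 # js) < n - 1 \<Longrightarrow> card (D_set f) \<noteq> 1"
proof
  assume "card (D_set f) = 1"
  then obtain m where "slopes = {m}" by (auto simp: card_D_set card_1_singleton_iff)
  moreover obtain m1 where "m1 \<in> slopes" "w m1 = 1" by (rule weight_one)
  ultimately have "q ^ 1 - 1 = q ^ n - 1" using sum_weights by simp
  moreover have "q ^ 1 < q ^ n" using q_ge_2 n_ge_2 by (intro power_strict_increasing) auto
  ultimately show False using q_ge_2 by simp
qed

section \<open>Intersection numbers of \<open>B_set f\<close>\<close>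

lemma B_small_weights:
  assumes "last (1 # js) < n - 1"
  shows "of_type (B_set f) ([1, q + 1] @ map (\<lambda>i. q ^ i + 1) js @ [card (D_set f)])"
    and "card (intersection_numbers (B_set f)) = length (1 # js) + 2"
proof -
  show "of_type (B_set f) ([1, q + 1] @ map (\<lambda>i. q ^ i + 1) js @ [card (D_set f)])"
    unfolding of_type_iff intersection_numbers_B' by auto
  have "card ((\<lambda>i. q ^ i + 1) ` set (1 # js)) = length (1 # js)"
    unfolding card_weights[symmetric] by (intro card_image) (simp add: inj_on_def)
  moreover have "1 \<notin> (\<lambda>i. q ^ i + 1) ` set (1 # js)" using q_ge_2 by auto
  moreover have "card (D_set f) \<notin> (\<lambda>i. q ^ i + 1) ` set (1 # js)"
    using card_D_ne[OF assms] by (metis (no_types, lifting) imageE)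
  ultimately show "card (intersection_numbers (B_set f)) = length (1 # js) + 2"
    using card_D_ne_1[OF assms]
    unfolding intersection_numbers_B' by (simp del: set_simps list.set image_insert)
qed

text \<open>Beside a point of weight \<open>n - 1\<close> all others have weight 1, so
  \<open>sum_weights\<close> gives \<open>card (D_set f) = q ^ (n - 1) + 1\<close> and the line at
  infinity yields no new number. For \<open>n = 2\<close> the two weights coincide.\<close>

lemma B_large_weight:
  assumes "last (1 # js) = n - 1"
  shows "n > 2 \<and> weight_distribution q f [1, n - 1] \<and> of_type (B_set f) [1, q + 1, q ^ (n - 1) + 1]
    \<or> n = 2 \<and> weight_distribution q f [1] \<and> of_type (B_set f) [1, q + 1]"
    and "PGammaL_equivalent (B_set f) (B_set (Tr_poly q n))"
proof -
  have "n - 1 \<in> w ` slopes" unfolding weights assms[symmetric] by (rule last_in_set) simp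
  then obtain m where m: "m \<in> slopes" "w m = n - 1" by auto
  then show "PGammaL_equivalent (B_set f) (B_set (Tr_poly q n))"
    using PGammaL_equivalent_trace by blast
  have other: "w k = 1" if "k \<in> slopes - {m}" for k
  proof -
    have "w k + w m \<le> n" "w k > 0" using that weight_sum_le[of k m] slopes_iff[of k] by auto
    then show ?thesis using m n_ge_2 by simp
  qed
  have "w ` slopes = {1, n - 1}"
  proof
    show "w ` slopes \<subseteq> {1, n - 1}"
    proof
      fix j assume "j \<in> w ` slopes"
      then obtain k where "k \<in> slopes" "j = w k" by blast
      then show "j \<in> {1, n - 1}" using m(2) other[of k] by (cases "k = m") auto
    qed
    have "1 \<in> w ` slopes" unfolding weights by simp
    then show "{1, n - 1} \<subseteq> w ` slopes" using m by force
  qed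
  have "(\<Sum>k\<in>slopes - {m}. q ^ w k - 1) = (\<Sum>k\<in>slopes - {m}. q - 1)"
    by (intro sum.cong) (simp_all add: other)
  then have sum: "q ^ n - 1 = (q ^ (n - 1) - 1) + card (slopes - {m}) * (q - 1)"
    using sum.remove[OF finite_slopes m(1), of "\<lambda>k. q ^ w k - 1"] sum_weights m(2) by simp
  \<comment> \<open>Writing \<open>r\<close> for \<open>q - 1\<close> avoids truncated subtraction
    in the factor to be cancelled.\<close>
  obtain r where r: "q = Suc r" using q_ge_2 by (cases q) auto
  have "q ^ n = q ^ (n - 1) * q" using n_ge_2 by (cases n) simp_all
  also have "\<dots> = q ^ (n - 1) + q ^ (n - 1) * r" using r by simp
  finally have "q ^ n = q ^ (n - 1) + q ^ (n - 1) * r" .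
  moreover have "q ^ n - 1 = (q ^ (n - 1) - 1) + card (slopes - {m}) * r" using sum r by simp
  moreover have "q ^ (n - 1) > 0" using q_ge_2 by simp
  ultimately have "card (slopes - {m}) * r = q ^ (n - 1) * r" by linarith
  then have "card (slopes - {m}) = q ^ (n - 1)" using r q_ge_2 by simp
  then have card: "card (D_set f) = q ^ (n - 1) + 1"
    using m(1) card_gt_0_iff[of slopes] by (auto simp: card_D_set card_Diff_singleton)
  show "n > 2 \<and> weight_distribution q f [1, n - 1] \<and> of_type (B_set f) [1, q + 1, q ^ (n - 1) + 1]
    \<or> n = 2 \<and> weight_distribution q f [1] \<and> of_type (B_set f) [1, q + 1]"
    unfolding of_type_iff intersection_numbers_B' weights[symmetric] \<open>w ` slopes = {1, n - 1}\<close>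
      weight_distribution_def weights_D_set card
    using n_ge_2 by (cases "n = 2") auto
qed

section \<open>Intersection numbers of \<open>C_set f\<close>\<close>

text \<open>For \<open>q \<ge> 3\<close> at least half of the line at infinity lies outside
  \<open>D_set f\<close>, whereas \<open>q ^ i\<close> is at most a third of
  \<open>q ^ n\<close>.\<close>

lemma C_size_bound:
  assumes "q > 2" "i \<in> set (1 # js)"
  shows "q ^ n + 1 - card (D_set f) \<noteq> q ^ i" "q ^ n + 1 - card (D_set f) > 2"
proof -
  have "2 * card slopes \<le> (q - 1) * card slopes" using assms(1) by (intro mult_right_mono) auto
  then have card: "2 * card slopes \<le> q ^ n - 1" using card_slopes_bound by linarith
  have "3 * q ^ i \<le> q * q ^ (n - 1)"
    using assms weight_range[OF assms(2)] by (intro mult_mono power_increasing) auto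
  also have "\<dots> = q ^ n" using n_ge_2 by (cases n) simp_all
  finally have le: "3 * q ^ i \<le> q ^ n" .
  have "q ^ 1 \<le> q ^ i" using weight_range[OF assms(2)] assms(1) by (intro power_increasing) auto
  then have "q ^ i > 2" using assms(1) by simp
  with card le show "q ^ n + 1 - card (D_set f) \<noteq> q ^ i" "q ^ n + 1 - card (D_set f) > 2"
    unfolding card_D_set by linarith+
qed

lemma C_type:
  "of_type (C_set f) ([0, 2, q] @ map (\<lambda>i. q ^ i) js @ [q ^ n + 1 - card (D_set f)])"
  unfolding of_type_iff intersection_numbers_C' by auto

lemma card_weight_powers: "card ((\<lambda>i. q ^ i) ` set (1 # js)) = length (1 # js)"
  unfolding card_weights[symmetric] by (intro card_image) (simp add: inj_on_def)

lemma C_numbers_q_gt_2: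
  assumes "q > 2"
  shows "card (intersection_numbers (C_set f)) = length (1 # js) + 3"
proof -
  have "q ^ i > 2" if "i \<in> set (1 # js)" for i
    using weight_range[OF that] assms power_increasing[of 1 i q] by simp
  then have "0 \<notin> (\<lambda>i. q ^ i) ` set (1 # js)" "2 \<notin> (\<lambda>i. q ^ i) ` set (1 # js)"
    by (metis (no_types, lifting) imageE not_less0, metis (no_types, lifting) imageE nat_neq_iff)
  moreover have "q ^ n + 1 - card (D_set f) \<notin> (\<lambda>i. q ^ i) ` set (1 # js)"
    using C_size_bound(1)[OF assms] by (metis (no_types, lifting) imageE)
  moreover have "q ^ n + 1 - card (D_set f) > 2"
    by (rule C_size_bound(2)[OF assms, of 1]) simp
  ultimately show ?thesis
    unfolding intersection_numbers_C' using card_weight_powers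
    by (simp del: list.set image_insert)
qed

text \<open>For \<open>q = 2\<close> each term of \<open>sum_weights\<close> is
  \<open>2 ^ w m - 2\<close> plus one, and the ones add up to \<open>card (D_set f)\<close>. Points
  of weight 1 thus contribute nothing to the excess over 2.\<close>

lemma C_size_binary:
  assumes "q = 2"
  shows "q ^ n + 1 - card (D_set f) = 2 + (\<Sum>m\<in>slopes. 2 ^ w m - 2)"
proof -
  have "2 ^ w m - 1 = (2 ^ w m - 2) + (1 :: nat)" if "m \<in> slopes" for m
    using that slopes_iff[of m] power_increasing[of 1 "w m" "2 :: nat"] by simp
  then have "(\<Sum>m\<in>slopes. 2 ^ w m - 1 :: nat) = (\<Sum>m\<in>slopes. (2 ^ w m - 2) + 1)"
    by (rule sum.cong[OF refl])
  then have "2 ^ n - 1 = (\<Sum>m\<in>slopes. 2 ^ w m - 2) + card slopes"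
    using sum_weights assms by (simp only: sum.distrib) simp
  moreover have "(2 :: nat) ^ n > 0" by simp
  ultimately show ?thesis unfolding card_D_set assms by linarith
qed

text \<open>With three weights there is, for any weight \<open>i\<close>, a point \<open>k\<close>
  of weight different from 1 and \<open>i\<close>. It adds at least 2 to the
  \<open>2 ^ i - 2\<close> from a point of weight \<open>i\<close>, so the size at infinity exceeds
  every \<open>2 ^ i\<close>.\<close>

lemma C_numbers_binary:
  assumes "q = 2" "length (1 # js) > 2"
  shows "card (intersection_numbers (C_set f)) = length (1 # js) + 2"
proof -
  have gt: "q ^ n + 1 - card (D_set f) > q ^ i" if i: "i \<in> set (1 # js)" for i
  proof -
    obtain m where m: "m \<in> slopes" "i = w m" using i unfolding weights[symmetric] by blast
    have "\<not> set (1 # js) \<subseteq> {1, i}"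
    proof
      assume "set (1 # js) \<subseteq> {1, i}"
      then have "card (set (1 # js)) \<le> card {1, i}" by (intro card_mono) auto
      also have "\<dots> \<le> 2" by (simp add: card_insert_if)
      finally show False using assms(2) card_weights by simp
    qed
    then obtain j where "j \<in> set (1 # js)" "j \<notin> {1, i}" by blast
    then obtain k where k: "k \<in> slopes" "w k \<noteq> 1" "w k \<noteq> i"
      unfolding weights[symmetric] by auto
    have "w k \<ge> 2" using k slopes_iff[of k] by simp
    then have k4: "(2 :: nat) ^ w k \<ge> 4" using power_increasing[of 2 "w k" "2 :: nat"] by simp
    have "(\<Sum>l\<in>{m, k}. 2 ^ w l - 2) \<le> (\<Sum>l\<in>slopes. 2 ^ w l - 2 :: nat)"
      using m k by (intro sum_mono2) auto
    moreover have "m \<noteq> k" using m k by auto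
    ultimately have "(2 ^ i - 2) + (2 ^ w k - 2) \<le> (\<Sum>l\<in>slopes. 2 ^ w l - 2 :: nat)"
      using m by simp
    then show ?thesis unfolding C_size_binary[OF assms(1)] using k4 assms(1) by simp
  qed
  have "0 \<notin> (\<lambda>i. q ^ i) ` set (1 # js)" using q_ge_2 by auto
  \<comment> \<open>The number 2 is already the power belonging to weight 1, hence one intersection
    number fewer than for \<open>q > 2\<close>.\<close>
  moreover have two: "insert 2 ((\<lambda>i. q ^ i) ` set (1 # js)) = (\<lambda>i. q ^ i) ` set (1 # js)"
    using assms(1) by auto
  moreover have "q ^ n + 1 - card (D_set f) \<notin> (\<lambda>i. q ^ i) ` set (1 # js)"
    using gt by (metis (no_types, lifting) imageE less_irrefl)
  moreover have "q ^ n + 1 - card (D_set f) \<noteq> 0" using gt[of 1] by simp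
  moreover have "intersection_numbers (C_set f) =
      insert 0 (insert (q ^ n + 1 - card (D_set f)) ((\<lambda>i. q ^ i) ` set (1 # js)))"
    unfolding intersection_numbers_C' using two by blast
  ultimately show ?thesis
    using card_weight_powers by (simp del: list.set image_insert)
qed

text \<open>Only the point of weight \<open>i\<close> contributes to \<open>C_size_binary\<close>,
  so the line at infinity has \<open>2 ^ i\<close> points in \<open>C_set f\<close>.\<close>

lemma C_club:
  assumes "q = 2" "js = [i]" "is_club q n f i"
  shows "of_type (C_set f) [0, 2, 2 ^ i]"
proof -
  obtain P where P: "P \<in> D_set f" "weight q f P = i"
    "\<And>Q. Q \<in> D_set f \<Longrightarrow> weight q f Q = i \<Longrightarrow> Q = P"
    using assms(3) unfolding is_club_def by blast
  obtain m where m: "m \<in> slopes" "w m = i" and Pm: "P = slope_point m"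
    using P(1,2) by (auto simp: D_set_eq w_def)
  have unique: "k = m" if "k \<in> slopes" "w k = i" for k
    using P(3)[of "slope_point k"] that by (simp add: D_set_eq w_def Pm)
  have "w k = 1" if "k \<in> slopes - {m}" for k
    using assms(3) that unique[of k] unfolding is_club_def D_set_eq w_def by auto
  then have "(\<Sum>k\<in>slopes - {m}. 2 ^ w k - 2 :: nat) = 0" by simp
  then have "(\<Sum>k\<in>slopes. 2 ^ w k - 2 :: nat) = 2 ^ i - 2"
    using sum.remove[OF finite_slopes m(1), of "\<lambda>k. 2 ^ w k - 2 :: nat"] m(2) by simp
  moreover have "(2 :: nat) ^ 1 \<le> 2 ^ i"
    using assms(3) by (intro power_increasing) (auto simp: is_club_def)
  ultimately have "q ^ n + 1 - card (D_set f) = 2 ^ i"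
    unfolding C_size_binary[OF assms(1)] by simp
  then show ?thesis unfolding of_type_iff intersection_numbers_C' using assms by auto
qed

text \<open>All summands of \<open>C_size_binary\<close> vanish, leaving \<open>2 = q\<close> points
  at infinity.\<close>

lemma C_scattered:
  assumes "q = 2" "js = []"
  shows "of_type (C_set f) [0, q]" and "scattered q f"
proof -
  have one: "w ` slopes = {1}" using weights assms by simp
  then show "scattered q f" unfolding scattered_def using weights_D_set by blast
  have "w m = 1" if "m \<in> slopes" for m
    using one imageI[OF that, of w] by simp
  then have "(\<Sum>m\<in>slopes. 2 ^ w m - 2 :: nat) = 0" by simp
  then have "q ^ n + 1 - card (D_set f) = 2" unfolding C_size_binary[OF assms(1)] by simp
  then show "of_type (C_set f) [0, q]"
    unfolding of_type_iff intersection_numbers_C' using assms by auto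
qed

end

theorem theorem3p1:
  fixes f :: "'a::{field,finite} poly"
    and q n t :: nat
    and js :: "nat list"
  assumes "primepow q" and "n \<ge> 2" and "CARD('a) = q ^ n"
    and "q_polynomial q n f"
    and "max_field_of_linearity_Fq q n f"
    and "weight_distribution q f (1 # js)"
    and "t = length (1 # js)"
  shows
    "\<comment> \<open>(i)\<close>
     (last (1 # js) < n - 1 \<longrightarrow>
        of_type (B_set f) ([1, q + 1] @ map (\<lambda>i. q ^ i + 1) js @ [card (D_set f)]) \<and>
        card (intersection_numbers (B_set f)) = t + 2)
     \<and>
     \<comment> \<open>(ii)\<close>
     (last (1 # js) = n - 1 \<longrightarrow>
        (n > 2 \<and> weight_distribution q f [1, n - 1] \<and>
           of_type (B_set f) [1, q + 1, q ^ (n - 1) + 1]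
         \<or> n = 2 \<and> weight_distribution q f [1] \<and>
           of_type (B_set f) [1, q + 1]) \<and>
        PGammaL_equivalent (B_set f) (B_set (Tr_poly q n)))
     \<and>
     \<comment> \<open>(j)\<close>
     (q > 2 \<longrightarrow>
        of_type (C_set f) ([0, 2, q] @ map (\<lambda>i. q ^ i) js @ [q ^ n + 1 - card (D_set f)]) \<and>
        card (intersection_numbers (C_set f)) = t + 3)
     \<and>
     \<comment> \<open>(jj)\<close>
     (q = 2 \<and> t > 2 \<longrightarrow>
        of_type (C_set f) ([0, q] @ map (\<lambda>i. q ^ i) js @ [q ^ n + 1 - card (D_set f)]) \<and>
        card (intersection_numbers (C_set f)) = t + 2)
     \<and>
     \<comment> \<open>(jjj)\<close>
     (\<forall>i. q = 2 \<and> t = 2 \<and> weight_distribution q f [1, i] \<longrightarrow>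
        (is_club q n f i \<longrightarrow> of_type (C_set f) [0, 2, 2 ^ i]) \<and>
        (\<not> is_club q n f i \<longrightarrow> of_type (C_set f) [0, 2, 2 ^ i, 2 ^ n + 1 - card (D_set f)]))
     \<and>
     \<comment> \<open>(jv)\<close>
     (q = 2 \<and> t = 1 \<longrightarrow> of_type (C_set f) [0, q] \<and> scattered q f)
     \<and>
     \<comment> \<open>line counts\<close>
     (last (1 # js) < n - 1 \<longrightarrow>
        (\<forall>i\<in>set (1 # js).
           card {l \<in> pg_lines. card (l \<inter> B_set f) = q ^ i + 1} = q ^ (n - i) * frequency q f i))
     \<and>
     (q > 2 \<longrightarrow>
        (\<forall>i\<in>set (1 # js).
           card {l \<in> pg_lines. card (l \<inter> C_set f) = q ^ i} = q ^ (n - i) * frequency q f i))"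
proof -
  interpret weighted_linear_set q n "TYPE('a)" f js
    using assms by unfold_locales
  \<comment> \<open>For \<open>q = 2\<close> the entries 2 and \<open>q\<close> of the list in
    \<open>C_type\<close> coincide.\<close>
  have type2: "of_type (C_set f) ([0, q] @ map (\<lambda>i. q ^ i) js @ [q ^ n + 1 - card (D_set f)])"
    if "q = 2"
    using C_type that unfolding of_type_iff by simp
  \<comment> \<open>Both lists enumerate the same set of weights, so the second entries
    agree.\<close>
  have js: "js = [i]" if "t = 2" "weight_distribution q f [1, i]" for i
  proof -
    have "1 < i" "set (1 # js) = {1, i}"
      using that(2) weights by (simp_all add: weight_distribution_def weights_D_set)
    moreover have "length js = Suc 0" using that(1) assms(7) by simp
    then obtain j where j: "js = [j]" by (auto simp: length_Suc_conv)
    moreover note j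
    moreover have "1 < j" using sorted_weights j by simp
    ultimately show ?thesis by (simp add: doubleton_eq_iff)
  qed
  have type3: "of_type (C_set f) [0, 2, 2 ^ i, 2 ^ n + 1 - card (D_set f)]" if "q = 2" "js = [i]" for i
    using C_type that unfolding of_type_iff by simp
  \<comment> \<open>Here \<open>card_D_ne\<close> excludes the line at infinity;
    \<open>C_size_bound\<close> does the same for \<open>linesC\<close>.\<close>
  have linesB: "card {l \<in> pg_lines. card (l \<inter> B_set f) = q ^ i + 1} = q ^ (n - i) * frequency q f i"
    if "last (1 # js) < n - 1" "i \<in> set (1 # js)" for i
    using card_D_ne[OF that] weight_range[OF that(2)] by (intro lines_B) (auto simp: card_D_set)
  have linesC: "card {l \<in> pg_lines. card (l \<inter> C_set f) = q ^ i} = q ^ (n - i) * frequency q f i"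
    if "q > 2" "i \<in> set (1 # js)" for i
    using C_size_bound(1)[OF that] weight_range[OF that(2)] that(1)
    by (intro lines_C) (auto simp: card_D_set)
  show ?thesis
    unfolding assms(7)
  proof (intro conjI impI allI ballI, goal_cases)
    case 1 then show ?case by (rule B_small_weights(1))
  next
    case 2 then show ?case by (rule B_small_weights(2))
  next
    case 3 then show ?case by (rule B_large_weight(1))
  next
    case 4 then show ?case by (rule B_large_weight(2))
  next
    case 5 show ?case by (rule C_type)
  next
    case 6 then show ?case by (rule C_numbers_q_gt_2)
  next
    case 7 then show ?case using type2 by blast
  next
    case 8 then show ?case using C_numbers_binary by blast
  next
    case (9 i) then show ?case using js[unfolded assms(7)] C_club by blast
  next
    case (10 i) then show ?case using js[unfolded assms(7)] type3 by blast
  next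
    case 11 then show ?case by (intro C_scattered(1)) auto
  next
    case 12 then show ?case by (intro C_scattered(2)) auto
  next
    case (13 i) then show ?case by (rule linesB)
  next
    case (14 i) then show ?case by (rule linesC)
  qed
qed

end
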